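(* Let $\mathcal{C}$ be a hereditary class of graphs such that every $n$-vertex graph $G\in\mathcal{C}$ has an $(a,c\,n^{1-b}\ln^\delta(n))$-clique-based separator, for some constants $a,b,c,\delta$ depending on $\mathcal{C}$. Then for every $n$-vertex graph $G\in\mathcal{C}$ and every $\lambda>0$, the mixing time of the Glauber dynamics on $G$ with fugacity $\lambda$ satisfies $$\tau_{G,\lambda}=(2\tilde{\lambda})^{O(n^{1-b}\ln^\delta(n))},$$ where $\tilde\lambda=e^{|\ln\lambda|}$ and the constant in $O(\cdot)$ depends only on $\mathcal{C}$.
   Context: Let $a\in(0,1)$ and $w>0$. A triple $(A,B,S)$ is an $(a,w)$-clique-based separation of a graph $G$ if $(A,B,S)$ is a partition of $V(G)$ with no edge between $A$ and $B$, $|A|\leqslant a|V(G)|$, $|B|\leqslant a|V(G)|$, and $S=\bigcup_{i=1}^k C_i$ for some cliques $C_1,\dots,C_k$ ($k\geqslant1$) with $\sum_{i=1}^k\log_2(|C_i|+1)\leqslant w$; $S$ is then an $(a,w)$-clique-based separator. A class is hereditary if closed under induced subgraphs. For a graph $G$ with $n$ vertices and $\lambda>0$: $\mathcal{I}(G)$ is the set of independent sets, $Z_G(\lambda)=\sum_{J\in\mathcal{I}(G)}\lambda^{|J|}$, $\pi_{G,\lambda}(I)=\lambda^{|I|}/Z_G(\lambda)$. The Glauber dynamics picks a uniform random vertex $v$; if $v\in I$ it is removed with probability $\frac1{\lambda+1}$; if $v\notin I$ and $I\cup\{v\}$ is independent it is added with probability $\frac{\lambda}{\lambda+1}$; otherwise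 nothing changes. The mixing time $\tau_{G,\lambda}$ is the least $t$ such that for every starting independent set, the total variation distance between the distribution after $t$ steps and $\pi_{G,\lambda}$ is at most $1/4$.
   Formalization: The constant b is assumed to satisfy b < 1, which the statement leaves open; for b = 1, δ = 0 the claim fails for edgeless graphs, whose mixing time is unbounded at λ = 1 while the stated bound is constant. *)

theory Defs
  imports "HOL-Probability.Probability" "Graph_Theory.Graph_Theory"
begin

text \<open>
  Finite simple graphs are the library's \<open>pair_graph\<close>s: finite vertex set, symmetric and
  irreflexive set of vertex pairs, an undirected edge being present in both orientations.
\<close>

definition graph_class :: "'a pair_pre_digraph set \<Rightarrow> bool" where
  "graph_class \<C> \<longleftrightarrow> (\<forall>G\<in>\<C>. pair_graph G)"

definition hereditary :: "'a pair_pre_digraph set \<Rightarrow> bool" where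
  "hereditary \<C> \<longleftrightarrow> (\<forall>G\<in>\<C>. \<forall>H. induced_subgraph (with_proj H) (with_proj G) \<longrightarrow> H \<in> \<C>)"

abbreviation num_verts :: "'a pair_pre_digraph \<Rightarrow> nat" where
  "num_verts G \<equiv> card (pverts G)"


section \<open>Clique-based separators\<close>

definition is_clique :: "'a pair_pre_digraph \<Rightarrow> 'a set \<Rightarrow> bool" where
  "is_clique G K \<longleftrightarrow> K \<subseteq> pverts G \<and> (\<forall>u\<in>K. \<forall>v\<in>K. u \<noteq> v \<longrightarrow> (u, v) \<in> parcs G)"

text \<open>
  The parts of the partition may be empty, and so may the cliques: the separator of a disconnected
  graph may be empty, which is expressed by a single empty clique of weight \<open>log 2 1 = 0\<close>.
\<close>

definition clique_based_separation ::
  "real \<Rightarrow> real \<Rightarrow> 'a pair_pre_digraph \<Rightarrow> 'a set \<Rightarrow> 'a set \<Rightarrow> 'a set \<Rightarrow> bool" where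
  "clique_based_separation a w G A B S \<longleftrightarrow>
     A \<union> B \<union> S = pverts G \<and> A \<inter> B = {} \<and> A \<inter> S = {} \<and> B \<inter> S = {} \<and>
     (\<forall>u\<in>A. \<forall>v\<in>B. (u, v) \<notin> parcs G) \<and>
     real (card A) \<le> a * real (num_verts G) \<and>
     real (card B) \<le> a * real (num_verts G) \<and>
     (\<exists>(k::nat) (K :: nat \<Rightarrow> 'a set). k \<ge> 1 \<and> (\<forall>i\<in>{1..k}. is_clique G (K i)) \<and>
        S = (\<Union>i\<in>{1..k}. K i) \<and>
        (\<Sum>i=1..k. log 2 (real (card (K i)) + 1)) \<le> w)"

definition clique_based_separator ::
  "real \<Rightarrow> real \<Rightarrow> 'a pair_pre_digraph \<Rightarrow> 'a set \<Rightarrow> bool" where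
  "clique_based_separator a w G S \<longleftrightarrow> (\<exists>A B. clique_based_separation a w G A B S)"


section \<open>The hard-core model and its Glauber dynamics\<close>

definition independent_sets :: "'a pair_pre_digraph \<Rightarrow> 'a set set" where
  "independent_sets G = {I. I \<subseteq> pverts G \<and> (\<forall>u\<in>I. \<forall>v\<in>I. (u, v) \<notin> parcs G)}"

definition partition_function :: "'a pair_pre_digraph \<Rightarrow> real \<Rightarrow> real" where
  "partition_function G lam = (\<Sum>J\<in>independent_sets G. lam ^ card J)"

definition hard_core_pmf :: "'a pair_pre_digraph \<Rightarrow> real \<Rightarrow> 'a set pmf" where
  "hard_core_pmf G lam = embed_pmf
     (\<lambda>I. if I \<in> independent_sets G then lam ^ card I / partition_function G lam else 0)"

lemma finite_independent_sets:
  assumes "pair_graph G"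
  shows "finite (independent_sets G)"
proof -
  interpret pair_graph G by fact
  have "independent_sets G \<subseteq> Pow (pverts G)"
    by (auto simp: independent_sets_def)
  then show ?thesis
    using pair_finite_verts by (simp add: finite_subset)
qed

lemma partition_function_pos:
  assumes "pair_graph G" "lam > 0"
  shows "partition_function G lam > 0"
proof -
  have "{} \<in> independent_sets G"
    by (simp add: independent_sets_def)
  then show ?thesis
    unfolding partition_function_def
    using finite_independent_sets[OF assms(1)] assms(2)
    by (intro sum_pos) auto
qed

text \<open>The weights are a probability mass function, so \<open>embed_pmf\<close> is used within its domain.\<close>

lemma pmf_hard_core_pmf:
  assumes "pair_graph G" "lam > 0"
  shows "pmf (hard_core_pmf G lam) I =
    (if I \<in> independent_sets G then lam ^ card I / partition_function G lam else 0)"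
proof -
  let ?f = "\<lambda>I. if I \<in> independent_sets G then lam ^ card I / partition_function G lam else 0"
  note fin = finite_independent_sets[OF assms(1)] and pos = partition_function_pos[OF assms]
  have nonneg: "0 \<le> ?f I" for I
    using pos assms(2) by simp
  have "(\<integral>\<^sup>+ x. ennreal (?f x) \<partial>count_space UNIV) = (\<Sum>x\<in>independent_sets G. ennreal (?f x))"
    by (rule nn_integral_count_space'[OF fin]) auto
  also have "\<dots> = ennreal (\<Sum>x\<in>independent_sets G. ?f x)"
    by (intro sum_ennreal nonneg)
  also have "(\<Sum>x\<in>independent_sets G. ?f x) = 1"
    using pos by (simp add: sum_divide_distrib[symmetric] partition_function_def)
  finally show ?thesis
    unfolding hard_core_pmf_def using nonneg by (subst pmf_embed_pmf) auto
qed

definition glauber_step :: "'a pair_pre_digraph \<Rightarrow> real \<Rightarrow> 'a set \<Rightarrow> 'a set pmf" where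
  "glauber_step G lam I = bind_pmf (pmf_of_set (pverts G)) (\<lambda>v.
     if v \<in> I then
       map_pmf (\<lambda>r. if r then I - {v} else I) (bernoulli_pmf (1 / (lam + 1)))
     else if insert v I \<in> independent_sets G then
       map_pmf (\<lambda>r. if r then insert v I else I) (bernoulli_pmf (lam / (lam + 1)))
     else return_pmf I)"

primrec glauber_dist :: "'a pair_pre_digraph \<Rightarrow> real \<Rightarrow> nat \<Rightarrow> 'a set \<Rightarrow> 'a set pmf" where
  "glauber_dist G lam 0 I = return_pmf I"
| "glauber_dist G lam (Suc t) I = bind_pmf (glauber_dist G lam t I) (glauber_step G lam)"

definition tv_dist :: "'s pmf \<Rightarrow> 's pmf \<Rightarrow> real" where
  "tv_dist p q = (SUP E. \<bar>measure_pmf.prob p E - measure_pmf.prob q E\<bar>)"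

text \<open>
  For a nonempty graph and \<open>lam > 0\<close> the dynamics is ergodic with stationary distribution
  \<open>hard_core_pmf G lam\<close>, so that the least such \<open>t\<close> exists.
\<close>

definition mixing_time :: "'a pair_pre_digraph \<Rightarrow> real \<Rightarrow> nat" where
  "mixing_time G lam = (LEAST t. \<forall>I\<in>independent_sets G.
     tv_dist (glauber_dist G lam t I) (hard_core_pmf G lam) \<le> 1 / 4)"

end

theory Submission
  imports Defs
begin

text \<open>
  Instead of counting canonical paths, one bounds the Poincare constant of the dynamics directly.
  Comparing \<open>f (insert v K)\<close> with \<open>f K\<close> shows that adding a clique \<open>C\<close> to a graph costs a factor
  \<open>1 + 2 * lam * card C\<close>, while the Efron--Stein inequality shows that a union without
  connecting edges costs nothing. Hence a separator of weight \<open>w\<close> costs a factor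
  \<open>(2 * exp \<bar>ln lam\<bar>) powr (2 * w)\<close>, and the weights met along the recursion are summed up by a
  geometric series. The Poincare inequality yields exponential decay of the variance, and the
  losses polynomial in \<open>n\<close> are absorbed because \<open>1 - b > 0\<close> makes the exponent grow at least like
  \<open>ln n\<close>.
\<close>

section \<open>Poincare inequalities for the hard-core model\<close>

text \<open>Why cliques: an independent set meets a clique \<open>C\<close> in one of only
  \<open>card C + 1\<close> ways, so the logarithm of the cost of deleting \<open>C\<close> is of
  the order of its weight \<open>log 2 (card C + 1)\<close>; an arbitrary separator would pay for
  all its subsets. Why a Poincare inequality: a union without connecting edges keeps the larger of
  the two constants instead of multiplying them. So the exponent obeys a recursion with a single
  branch, \<open>2 * w n + h m \<le> h n\<close> with \<open>m \<le> a * n\<close>, and does not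
  collect the separators of the whole recursion tree. The price is paid at the end, when a
  worst-case start is compared with equilibrium. This costs the reciprocal of the smallest
  stationary probability, at most \<open>(2 * exp \<bar>ln lam\<bar>) ^ (2 * n)\<close>, but only
  its logarithm enters the mixing time, which loses a factor polynomial in \<open>n\<close> and in
  \<open>exp \<bar>ln lam\<bar>\<close>. A graph with one vertex is treated exactly, because there
  the claimed exponent is \<open>0\<close>.\<close>

lemma weighted_sum_squares_shift:
  fixes w f :: "'b \<Rightarrow> real"
  assumes "sum w X \<noteq> 0"
  shows "(\<Sum>x\<in>X. w x * (f x - m)\<^sup>2) =
    (\<Sum>x\<in>X. w x * (f x - (\<Sum>y\<in>X. w y * f y) / sum w X)\<^sup>2)
      + sum w X * ((\<Sum>y\<in>X. w y * f y) / sum w X - m)\<^sup>2"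
proof -
  define \<mu> where "\<mu> = (\<Sum>y\<in>X. w y * f y) / sum w X"
  have "(\<Sum>x\<in>X. w x * (f x - m)\<^sup>2) =
    (\<Sum>x\<in>X. w x * (f x - \<mu>)\<^sup>2 + (2 * (\<mu> - m) * (w x * f x) + w x * (m\<^sup>2 - \<mu>\<^sup>2)))"
    by (intro sum.cong refl) (simp add: power2_eq_square algebra_simps)
  also have "\<dots> = (\<Sum>x\<in>X. w x * (f x - \<mu>)\<^sup>2)
      + (2 * (\<mu> - m) * (\<Sum>x\<in>X. w x * f x) + sum w X * (m\<^sup>2 - \<mu>\<^sup>2))"
    by (simp add: sum.distrib sum_distrib_left sum_distrib_right)
  also have "(\<Sum>x\<in>X. w x * f x) = sum w X * \<mu>"
    using assms by (simp add: \<mu>_def)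
  also have "2 * (\<mu> - m) * (sum w X * \<mu>) + sum w X * (m\<^sup>2 - \<mu>\<^sup>2) = sum w X * (\<mu> - m)\<^sup>2"
    by (simp add: power2_eq_square algebra_simps)
  finally show ?thesis
    by (simp add: \<mu>_def)
qed

text \<open>Jensen's inequality, read off from the variance identity at centre \<open>0\<close> by
  dropping the variance. It serves for averages over the configurations of one part and, with unit
  weights, for the average over the updated vertex.\<close>

lemma weighted_mean_square_le:
  fixes w f :: "'b \<Rightarrow> real"
  assumes "sum w X \<noteq> 0" "\<And>x. x \<in> X \<Longrightarrow> w x \<ge> 0"
  shows "sum w X * ((\<Sum>x\<in>X. w x * f x) / sum w X)\<^sup>2 \<le> (\<Sum>x\<in>X. w x * (f x)\<^sup>2)"
proof -
  have "0 \<le> (\<Sum>x\<in>X. w x * (f x - (\<Sum>y\<in>X. w y * f y) / sum w X)\<^sup>2)"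
    using assms(2) by (intro sum_nonneg) simp
  then show ?thesis
    using weighted_sum_squares_shift[OF assms(1), of f 0] by simp
qed

text \<open>Arcs and vertices are separate parameters, so that deleting vertices only shrinks
  \<open>U\<close> under a fixed \<open>E\<close>.\<close>

definition indep :: "('a \<times> 'a) set \<Rightarrow> 'a set \<Rightarrow> 'a set set" where
  "indep E U = {I. I \<subseteq> U \<and> (\<forall>u\<in>I. \<forall>v\<in>I. (u, v) \<notin> E)}"

lemma independent_sets_eq_indep: "independent_sets G = indep (parcs G) (pverts G)"
  by (simp add: independent_sets_def indep_def)

lemma finite_indep [simp]: "finite U \<Longrightarrow> finite (indep E U)"
  by (rule finite_subset[of _ "Pow U"]) (auto simp: indep_def)

lemma empty_in_indep [simp]: "{} \<in> indep E U"
  by (simp add: indep_def)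

definition weight_sum :: "('a \<times> 'a) set \<Rightarrow> real \<Rightarrow> 'a set \<Rightarrow> real" where
  "weight_sum E lam U = (\<Sum>I\<in>indep E U. lam ^ card I)"

lemma weight_sum_pos:
  assumes "finite U" "lam > 0"
  shows "weight_sum E lam U > 0"
  unfolding weight_sum_def
  by (rule sum_pos2[of _ "{}"]) (use assms in auto)

text \<open>The Dirichlet form of the update at \<open>v\<close>: each pair \<open>K\<close>,
  \<open>insert v K\<close> occurs once, with the weight of the smaller set. Times
  \<open>lam / (1 + lam)\<close> it is the unnormalized mean of the variance of \<open>f\<close>
  given the configuration off \<open>v\<close>.\<close>

definition local_energy ::
  "('a \<times> 'a) set \<Rightarrow> real \<Rightarrow> 'a set \<Rightarrow> ('a set \<Rightarrow> real) \<Rightarrow> 'a \<Rightarrow> real" where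
  "local_energy E lam U f v =
    (\<Sum>K | v \<notin> K \<and> insert v K \<in> indep E U. lam ^ card K * (f (insert v K) - f K)\<^sup>2)"

lemma finite_local_pairs [simp]: "finite U \<Longrightarrow> finite {K. v \<notin> K \<and> insert v K \<in> indep E U}"
  by (rule finite_subset[of _ "Pow U"]) (auto simp: indep_def)

lemma local_energy_nonneg: "lam > 0 \<Longrightarrow> local_energy E lam U f v \<ge> 0"
  unfolding local_energy_def by (intro sum_nonneg) simp

text \<open>The weight of \<open>K\<close> does not change with the ambient vertex set, so the pairs
  inside \<open>R\<close> are some of the summands for \<open>U\<close>.\<close>

lemma local_energy_mono:
  assumes "finite U" "R \<subseteq> U" "lam > 0"
  shows "local_energy E lam R f v \<le> local_energy E lam U f v"
  unfolding local_energy_def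
  by (rule sum_mono2) (use assms in \<open>auto simp: indep_def\<close>)

text \<open>
  The weights \<open>lam ^ card I\<close> are not normalized, and the variance is taken around an
  arbitrary centre, which is no loss since the mean is the best one.
\<close>

definition poincare :: "('a \<times> 'a) set \<Rightarrow> real \<Rightarrow> 'a set \<Rightarrow> real \<Rightarrow> bool" where
  "poincare E lam U \<gamma> \<longleftrightarrow> (\<forall>f. \<exists>m.
    (\<Sum>I\<in>indep E U. lam ^ card I * (f I - m)\<^sup>2) \<le> \<gamma> * (\<Sum>v\<in>U. local_energy E lam U f v))"

lemma poincare_mono:
  assumes "poincare E lam U \<gamma>" "\<gamma> \<le> \<gamma>'" "lam > 0"
  shows "poincare E lam U \<gamma>'"
  unfolding poincare_def
proof
  fix f
  obtain m where "(\<Sum>I\<in>indep E U. lam ^ card I * (f I - m)\<^sup>2)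
      \<le> \<gamma> * (\<Sum>v\<in>U. local_energy E lam U f v)"
    using assms(1) unfolding poincare_def by blast
  also have "\<dots> \<le> \<gamma>' * (\<Sum>v\<in>U. local_energy E lam U f v)"
    using assms(2,3) by (intro mult_right_mono sum_nonneg local_energy_nonneg)
  finally show "\<exists>m. (\<Sum>I\<in>indep E U. lam ^ card I * (f I - m)\<^sup>2)
      \<le> \<gamma>' * (\<Sum>v\<in>U. local_energy E lam U f v)" by blast
qed

lemma poincare_mean:
  assumes "poincare E lam U \<gamma>" "finite U" "lam > 0"
  shows "(\<Sum>I\<in>indep E U. lam ^ card I *
      (f I - (\<Sum>J\<in>indep E U. lam ^ card J * f J) / weight_sum E lam U)\<^sup>2)
    \<le> \<gamma> * (\<Sum>v\<in>U. local_energy E lam U f v)"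
proof -
  obtain m where m: "(\<Sum>I\<in>indep E U. lam ^ card I * (f I - m)\<^sup>2)
      \<le> \<gamma> * (\<Sum>v\<in>U. local_energy E lam U f v)"
    using assms(1) unfolding poincare_def by blast
  have pos: "(\<Sum>I\<in>indep E U. lam ^ card I) > 0"
    using weight_sum_pos[OF assms(2,3)] by (simp add: weight_sum_def)
  show ?thesis
    using weighted_sum_squares_shift[of "\<lambda>I. lam ^ card I" "indep E U" f m] pos m
    unfolding weight_sum_def
    by (smt (verit) mult_nonneg_nonneg zero_le_power2)
qed

lemma poincare_empty: "poincare E lam {} \<gamma>"
  unfolding poincare_def
proof
  fix f :: "'a set \<Rightarrow> real"
  have "indep E {} = {{}}"
    by (auto simp: indep_def)
  then show "\<exists>m. (\<Sum>I\<in>indep E {}. lam ^ card I * (f I - m)\<^sup>2)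
      \<le> \<gamma> * (\<Sum>v\<in>{}. local_energy E lam {} f v)"
    by (intro exI[of _ "f {}"]) simp
qed

text \<open>An independent set meeting \<open>C\<close> is \<open>insert v K\<close> for exactly one
  \<open>v\<close> in \<open>C\<close>, with \<open>K\<close> in the rest. Moving from
  \<open>insert v K\<close> to \<open>K\<close> costs one summand of the energy at \<open>v\<close>,
  and the deviation left at \<open>K\<close> is covered by the inequality for \<open>U - C\<close>.
  Each \<open>K\<close> is reached from at most \<open>card C\<close> sets, each \<open>lam\<close>
  times as heavy; the \<open>2\<close> comes from squaring a sum of two terms.\<close>

lemma poincare_clique:
  assumes fin: "finite U" and C: "C \<subseteq> U" "\<And>u v. u \<in> C \<Longrightarrow> v \<in> C \<Longrightarrow> u \<noteq> v \<Longrightarrow> (u, v) \<in> E"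
    and P: "poincare E lam (U - C) \<gamma>" and "\<gamma> \<ge> 1" "lam > 0"
  shows "poincare E lam U ((1 + 2 * lam * card C) * \<gamma>)"
  unfolding poincare_def
proof
  fix f
  let ?R = "U - C"
  let ?e = "local_energy E lam U f"
  define T where "T v = {K. v \<notin> K \<and> insert v K \<in> indep E U \<and> K \<in> indep E ?R}" for v
  have finT: "finite (T v)" for v
    by (rule finite_subset[of _ "Pow U"]) (use fin in \<open>auto simp: T_def indep_def\<close>)
  have finC: "finite C"
    using fin C(1) finite_subset by blast
  obtain m where m: "(\<Sum>I\<in>indep E ?R. lam ^ card I * (f I - m)\<^sup>2)
      \<le> \<gamma> * (\<Sum>v\<in>?R. local_energy E lam ?R f v)"
    using P unfolding poincare_def by blast
  define V where "V = (\<Sum>I\<in>indep E ?R. lam ^ card I * (f I - m)\<^sup>2)"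
  have Ve: "V \<le> \<gamma> * (\<Sum>v\<in>?R. ?e v)"
    unfolding V_def using \<open>\<gamma> \<ge> 1\<close> \<open>lam > 0\<close> fin
    by (intro order_trans[OF m] mult_left_mono sum_mono local_energy_mono) auto
  let ?g = "\<lambda>I. lam ^ card I * (f I - m)\<^sup>2"
  have split: "indep E U = indep E ?R \<union> (\<lambda>(v, K). insert v K) ` (SIGMA v:C. T v)"
  proof (intro equalityI subsetI)
    fix I assume I: "I \<in> indep E U"
    show "I \<in> indep E ?R \<union> (\<lambda>(v, K). insert v K) ` (SIGMA v:C. T v)"
    proof (cases "I \<inter> C = {}")
      case True
      then show ?thesis using I by (auto simp: indep_def)
    next
      case False
      then obtain v where v: "v \<in> I" "v \<in> C" by auto
      have "I - {v} \<in> T v"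
        using I v C(2) by (fastforce simp: T_def indep_def insert_absorb)
      then have "(v, I - {v}) \<in> (SIGMA v:C. T v)" "I = (\<lambda>(v, K). insert v K) (v, I - {v})"
        using v by auto
      then show ?thesis by blast
    qed
  qed (auto simp: T_def indep_def)
  have *: "(\<Sum>K\<in>T v. ?g (insert v K)) \<le> 2 * lam * ?e v + 2 * lam * V" if "v \<in> C" for v
  proof -
    have "(\<Sum>K\<in>T v. ?g (insert v K)) \<le>
      (\<Sum>K\<in>T v. 2 * lam * (lam ^ card K * (f (insert v K) - f K)\<^sup>2) + 2 * lam * ?g K)"
    proof (rule sum_mono)
      fix K assume K: "K \<in> T v"
      have "finite K" "v \<notin> K"
        using K fin by (auto simp: T_def indep_def intro: finite_subset)
      then have card: "card (insert v K) = Suc (card K)" by simp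
      have "(f (insert v K) - m)\<^sup>2 \<le> 2 * (f (insert v K) - f K)\<^sup>2 + 2 * (f K - m)\<^sup>2"
        using zero_le_power2[of "f (insert v K) - 2 * f K + m"]
        by (simp add: power2_eq_square algebra_simps)
      then have "lam * lam ^ card K * (f (insert v K) - m)\<^sup>2
        \<le> lam * lam ^ card K * (2 * (f (insert v K) - f K)\<^sup>2 + 2 * (f K - m)\<^sup>2)"
        using \<open>lam > 0\<close> by (intro mult_left_mono) auto
      then show "?g (insert v K) \<le>
          2 * lam * (lam ^ card K * (f (insert v K) - f K)\<^sup>2) + 2 * lam * ?g K"
        by (simp add: card algebra_simps)
    qed
    also have "\<dots> = 2 * lam * (\<Sum>K\<in>T v. lam ^ card K * (f (insert v K) - f K)\<^sup>2)
        + 2 * lam * (\<Sum>K\<in>T v. ?g K)"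
      by (simp add: sum.distrib sum_distrib_left)
    also have "\<dots> \<le> 2 * lam * ?e v + 2 * lam * V"
      unfolding local_energy_def V_def
      by (intro add_mono mult_left_mono sum_mono2) (use \<open>lam > 0\<close> fin in \<open>auto simp: T_def\<close>)
    finally show ?thesis .
  qed
  have "(\<Sum>I\<in>indep E U. ?g I)
      \<le> V + (\<Sum>I\<in>(\<lambda>(v, K). insert v K) ` (SIGMA v:C. T v). ?g I)"
    unfolding split V_def
    by (subst sum.union_inter[symmetric]) 
       (use fin finC finT \<open>lam > 0\<close> in \<open>auto intro!: sum_nonneg\<close>)
  also have "(\<Sum>I\<in>(\<lambda>(v, K). insert v K) ` (SIGMA v:C. T v). ?g I)
      \<le> (\<Sum>p\<in>(SIGMA v:C. T v). ?g (insert (fst p) (snd p)))"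
    using sum_image_le[of "SIGMA v:C. T v" ?g "\<lambda>(v, K). insert v K"] finC finT \<open>lam > 0\<close>
    by (simp add: o_def case_prod_unfold)
  also have "\<dots> = (\<Sum>v\<in>C. \<Sum>K\<in>T v. ?g (insert v K))"
    using finC finT by (subst sum.Sigma) (auto simp: case_prod_unfold)
  also have "\<dots> \<le> (\<Sum>v\<in>C. 2 * lam * ?e v + 2 * lam * V)"
    using * by (rule sum_mono)
  also have "V + \<dots> = (1 + 2 * lam * card C) * V + 2 * lam * (\<Sum>v\<in>C. ?e v)"
    by (simp add: sum.distrib sum_distrib_left algebra_simps)
  \<comment> \<open>If \<open>C\<close> is nonempty, \<open>2 * lam\<close> is at most the factor
    \<open>1 + 2 * lam * card C\<close>; if it is empty, the second sum vanishes.\<close>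
  also have "\<dots> \<le> (1 + 2 * lam * card C) * (\<gamma> * (\<Sum>v\<in>?R. ?e v))
      + (1 + 2 * lam * card C) * \<gamma> * (\<Sum>v\<in>C. ?e v)"
  proof (cases "C = {}")
    case False
    then have "1 \<le> card C" using finC by (simp add: Suc_le_eq card_gt_0_iff)
    then have "lam * 1 \<le> lam * card C" using \<open>lam > 0\<close> by (intro mult_left_mono) auto
    then have "2 * lam \<le> (1 + 2 * lam * card C) * 1" by simp
    also have "\<dots> \<le> (1 + 2 * lam * card C) * \<gamma>"
      using \<open>\<gamma> \<ge> 1\<close> \<open>lam > 0\<close> by (intro mult_left_mono) auto
    finally show ?thesis
      using Ve \<open>lam > 0\<close>
      by (intro add_mono mult_left_mono mult_right_mono sum_nonneg local_energy_nonneg) auto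
  qed (use Ve in simp)
  also have "\<dots> = (1 + 2 * lam * card C) * \<gamma> * ((\<Sum>v\<in>?R. ?e v) + (\<Sum>v\<in>C. ?e v))"
    by (simp add: algebra_simps)
  also have "(\<Sum>v\<in>?R. ?e v) + (\<Sum>v\<in>C. ?e v) = (\<Sum>v\<in>U. ?e v)"
    using sum.subset_diff[OF C(1) fin, of ?e] by simp
  finally show "\<exists>m. (\<Sum>I\<in>indep E U. lam ^ card I * (f I - m)\<^sup>2)
      \<le> (1 + 2 * lam * card C) * \<gamma> * (\<Sum>v\<in>U. ?e v)"
    by (intro exI[of _ m]) simp
qed

section \<open>Product structure of unions without connecting edges\<close>

lemma sum_indep_Un:
  assumes fin: "finite A" "finite B" and disj: "A \<inter> B = {}"
    and no: "\<And>u v. u \<in> A \<Longrightarrow> v \<in> B \<Longrightarrow> (u, v) \<notin> E \<and> (v, u) \<notin> E"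
  shows "(\<Sum>I\<in>indep E (A \<union> B). lam ^ card I * g I) =
    (\<Sum>L\<in>indep E B. \<Sum>K\<in>indep E A. lam ^ card L * (lam ^ card K * (g (K \<union> L) :: real)))"
proof -
  have "(\<Sum>I\<in>indep E (A \<union> B). lam ^ card I * g I) =
    (\<Sum>(L, K)\<in>indep E B \<times> indep E A. lam ^ card L * (lam ^ card K * g (K \<union> L)))"
  proof (rule sum.reindex_bij_witness[of _ "\<lambda>(L, K). K \<union> L" "\<lambda>I. (I \<inter> B, I \<inter> A)"])
    fix I assume I: "I \<in> indep E (A \<union> B)"
    then have "I = (I \<inter> A) \<union> (I \<inter> B)" by (auto simp: indep_def)
    moreover have "card ((I \<inter> A) \<union> (I \<inter> B)) = card (I \<inter> A) + card (I \<inter> B)"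
      using fin disj by (intro card_Un_disjoint) auto
    ultimately show "(case (I \<inter> B, I \<inter> A) of (L, K) \<Rightarrow> lam ^ card L * (lam ^ card K * g (K \<union> L)))
        = lam ^ card I * g I"
      by (metis (no_types, lifting) case_prod_conv mult.assoc mult.commute power_add)
  qed (use disj in \<open>auto simp: indep_def, (metis no subsetD)+\<close>)
  then show ?thesis
    by (simp add: sum.cartesian_product)
qed

lemma local_energy_Un:
  assumes fin: "finite A" "finite B" and disj: "A \<inter> B = {}"
    and no: "\<And>u v. u \<in> A \<Longrightarrow> v \<in> B \<Longrightarrow> (u, v) \<notin> E \<and> (v, u) \<notin> E" and v: "v \<in> A"
  shows "local_energy E lam (A \<union> B) f v =
    (\<Sum>L\<in>indep E B. lam ^ card L * local_energy E lam A (\<lambda>K. f (K \<union> L)) v)"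
proof -
  let ?T = "{K. v \<notin> K \<and> insert v K \<in> indep E A}"
  have "local_energy E lam (A \<union> B) f v =
    (\<Sum>(L, K)\<in>indep E B \<times> ?T. lam ^ card L * (lam ^ card K * (f (insert v K \<union> L) - f (K \<union> L))\<^sup>2))"
    unfolding local_energy_def
  proof (rule sum.reindex_bij_witness[of _ "\<lambda>(L, K). K \<union> L" "\<lambda>I. (I \<inter> B, I \<inter> A)"])
    fix I assume I: "I \<in> {I. v \<notin> I \<and> insert v I \<in> indep E (A \<union> B)}"
    then have eq: "I = (I \<inter> A) \<union> (I \<inter> B)" by (auto simp: indep_def)
    have "card ((I \<inter> A) \<union> (I \<inter> B)) = card (I \<inter> A) + card (I \<inter> B)"
      using fin disj by (intro card_Un_disjoint) auto
    then have card: "lam ^ card I = lam ^ card (I \<inter> B) * lam ^ card (I \<inter> A)"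
      using eq by (metis add.commute power_add)
    have "insert v (I \<inter> A) \<union> (I \<inter> B) = insert v I" "(I \<inter> A) \<union> (I \<inter> B) = I"
      using eq by auto
    then show "(case (I \<inter> B, I \<inter> A) of (L, K) \<Rightarrow>
          lam ^ card L * (lam ^ card K * (f (insert v K \<union> L) - f (K \<union> L))\<^sup>2))
        = lam ^ card I * (f (insert v I) - f I)\<^sup>2"
      by (simp only: prod.case card mult.assoc)
  qed (use disj no v in \<open>auto simp: indep_def, (metis no subsetD)+\<close>)
  then show ?thesis
    by (simp add: sum.cartesian_product[symmetric] local_energy_def sum_distrib_left)
qed

text \<open>The variance splits into the variance over \<open>A\<close> for a fixed part
  \<open>L\<close> in \<open>B\<close>, and the variance over \<open>B\<close> of the conditional
  mean \<open>F L\<close>. \<open>PA\<close> handles the first. \<open>PB\<close> bounds the second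
  by the energy of \<open>F\<close>, which by convexity is at most the averaged energy of
  \<open>f\<close>. The two bounds use disjoint sets of vertices, so \<open>\<gamma>\<close> does
  not grow.\<close>

lemma poincare_Un:
  assumes fin: "finite A" "finite B" and disj: "A \<inter> B = {}"
    and no: "\<And>u v. u \<in> A \<Longrightarrow> v \<in> B \<Longrightarrow> (u, v) \<notin> E \<and> (v, u) \<notin> E"
    and PA: "poincare E lam A \<gamma>" and PB: "poincare E lam B \<gamma>" and "\<gamma> \<ge> 0" "lam > 0"
  shows "poincare E lam (A \<union> B) \<gamma>"
  unfolding poincare_def
proof
  fix f
  let ?w = "\<lambda>I::'a set. lam ^ card I"
  define Z where "Z = weight_sum E lam A"
  have Z: "Z > 0" using weight_sum_pos fin \<open>lam > 0\<close> by (simp add: Z_def)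
  have Zsum: "Z = sum ?w (indep E A)" by (simp add: Z_def weight_sum_def)
  define F where "F L = (\<Sum>K\<in>indep E A. ?w K * f (K \<union> L)) / Z" for L
  obtain m where m: "(\<Sum>L\<in>indep E B. ?w L * (F L - m)\<^sup>2) \<le> \<gamma> * (\<Sum>v\<in>B. local_energy E lam B F v)"
    using PB unfolding poincare_def by blast
  have A: "(\<Sum>K\<in>indep E A. ?w K * (f (K \<union> L) - F L)\<^sup>2)
      \<le> \<gamma> * (\<Sum>v\<in>A. local_energy E lam A (\<lambda>K. f (K \<union> L)) v)" for L
    using poincare_mean[OF PA fin(1) \<open>lam > 0\<close>, of "\<lambda>K. f (K \<union> L)"] by (simp add: F_def Z_def)
  \<comment> \<open>Differences of \<open>F\<close> are averages over \<open>A\<close> of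
    differences of \<open>f\<close>, so Jensen applies; \<open>Z\<close> compensates for the
    normalization inside \<open>F\<close>.\<close>
  have B: "Z * local_energy E lam B F v
      \<le> (\<Sum>K\<in>indep E A. ?w K * local_energy E lam B (\<lambda>L. f (K \<union> L)) v)" for v
  proof -
    let ?T = "{L. v \<notin> L \<and> insert v L \<in> indep E B}"
    have "Z * (F (insert v L) - F L)\<^sup>2
        \<le> (\<Sum>K\<in>indep E A. ?w K * (f (K \<union> insert v L) - f (K \<union> L))\<^sup>2)" for L
      using weighted_mean_square_le[of ?w "indep E A" "\<lambda>K. f (K \<union> insert v L) - f (K \<union> L)"] Z \<open>lam > 0\<close>
      by (simp add: F_def Zsum sum_subtractf right_diff_distrib diff_divide_distrib)
    then have "(\<Sum>L\<in>?T. ?w L * (Z * (F (insert v L) - F L)\<^sup>2))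
        \<le> (\<Sum>L\<in>?T. ?w L * (\<Sum>K\<in>indep E A. ?w K * (f (K \<union> insert v L) - f (K \<union> L))\<^sup>2))"
      using \<open>lam > 0\<close> by (intro sum_mono mult_left_mono) auto
    also have "\<dots> = (\<Sum>K\<in>indep E A. ?w K * local_energy E lam B (\<lambda>L. f (K \<union> L)) v)"
      unfolding local_energy_def sum_distrib_left
      by (subst sum.swap) (simp add: mult.left_commute)
    finally show ?thesis
      by (simp add: local_energy_def sum_distrib_left mult.left_commute)
  qed
  have "(\<Sum>I\<in>indep E (A \<union> B). ?w I * (f I - m)\<^sup>2)
      = (\<Sum>L\<in>indep E B. ?w L * (\<Sum>K\<in>indep E A. ?w K * (f (K \<union> L) - m)\<^sup>2))"
    using sum_indep_Un[OF fin disj no, where g = "\<lambda>I. (f I - m)\<^sup>2"]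
    by (simp add: sum_distrib_left)
  also have "\<dots> = (\<Sum>L\<in>indep E B. ?w L *
      ((\<Sum>K\<in>indep E A. ?w K * (f (K \<union> L) - F L)\<^sup>2) + Z * (F L - m)\<^sup>2))"
    using Z weighted_sum_squares_shift[of ?w "indep E A" "\<lambda>K. f (K \<union> _)" m]
    by (simp add: F_def Zsum)
  also have "\<dots> = (\<Sum>L\<in>indep E B. ?w L * (\<Sum>K\<in>indep E A. ?w K * (f (K \<union> L) - F L)\<^sup>2))
      + Z * (\<Sum>L\<in>indep E B. ?w L * (F L - m)\<^sup>2)"
    by (simp add: distrib_left sum.distrib sum_distrib_left mult.left_commute)
  also have "\<dots> \<le> (\<Sum>L\<in>indep E B. ?w L * (\<gamma> * (\<Sum>v\<in>A. local_energy E lam A (\<lambda>K. f (K \<union> L)) v)))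
      + Z * (\<gamma> * (\<Sum>v\<in>B. local_energy E lam B F v))"
    using A m Z \<open>lam > 0\<close> by (intro add_mono sum_mono mult_left_mono) auto
  also have "(\<Sum>L\<in>indep E B. ?w L * (\<gamma> * (\<Sum>v\<in>A. local_energy E lam A (\<lambda>K. f (K \<union> L)) v)))
      = \<gamma> * (\<Sum>v\<in>A. local_energy E lam (A \<union> B) f v)"
    using local_energy_Un[OF fin disj no, of _ lam f] fin
    by (simp add: sum_distrib_left mult.left_commute) (rule sum.swap)
  also have "Z * (\<gamma> * (\<Sum>v\<in>B. local_energy E lam B F v))
      = \<gamma> * (\<Sum>v\<in>B. Z * local_energy E lam B F v)"
    by (simp add: sum_distrib_left mult.left_commute)
  also have "\<dots> \<le> \<gamma> * (\<Sum>v\<in>B. \<Sum>K\<in>indep E A. ?w K * local_energy E lam B (\<lambda>L. f (K \<union> L)) v)"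
    using B \<open>\<gamma> \<ge> 0\<close> by (intro mult_left_mono sum_mono) auto
  also have "\<dots> = \<gamma> * (\<Sum>v\<in>B. local_energy E lam (A \<union> B) f v)"
  proof -
    have "local_energy E lam (B \<union> A) f v =
        (\<Sum>K\<in>indep E A. ?w K * local_energy E lam B (\<lambda>L. f (L \<union> K)) v)" if "v \<in> B" for v
      using disj no that by (intro local_energy_Un fin) auto
    then show ?thesis by (simp add: Un_commute)
  qed
  finally have "(\<Sum>I\<in>indep E (A \<union> B). ?w I * (f I - m)\<^sup>2)
      \<le> \<gamma> * (\<Sum>v\<in>A \<union> B. local_energy E lam (A \<union> B) f v)"
    using fin disj by (simp add: sum.union_disjoint distrib_left)
  then show "\<exists>m. (\<Sum>I\<in>indep E (A \<union> B). ?w I * (f I - m)\<^sup>2)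
      \<le> \<gamma> * (\<Sum>v\<in>A \<union> B. local_energy E lam (A \<union> B) f v)" by blast
qed


section \<open>Decay of the variance and mixing\<close>

text \<open>Heat-bath resampling at \<open>v\<close>: the conditional expectation of
  \<open>f\<close> given the configuration off \<open>v\<close>. The last case is that of a vertex
  that cannot be added.\<close>

definition site_update ::
  "('a \<times> 'a) set \<Rightarrow> real \<Rightarrow> 'a set \<Rightarrow> 'a \<Rightarrow> ('a set \<Rightarrow> real) \<Rightarrow> 'a set \<Rightarrow> real" where
  "site_update E lam U v f I =
    (if v \<in> I then (f (I - {v}) + lam * f I) / (1 + lam)
     else if insert v I \<in> indep E U then (f I + lam * f (insert v I)) / (1 + lam)
     else f I)"

text \<open>These are the blocks on which resampling \<open>v\<close> acts: the pairs
  \<open>K\<close>, \<open>insert v K\<close>, and the single configurations in which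
  \<open>v\<close> is absent and blocked.\<close>

lemma sum_indep_pairs:
  assumes "finite U" "v \<in> U"
  shows "sum g (indep E U) = (\<Sum>K | v \<notin> K \<and> insert v K \<in> indep E U. g K + g (insert v K))
    + (\<Sum>I | v \<notin> I \<and> I \<in> indep E U \<and> insert v I \<notin> indep E U. (g I :: real))"
proof -
  let ?T = "{K. v \<notin> K \<and> insert v K \<in> indep E U}"
  let ?N = "{I. v \<notin> I \<and> I \<in> indep E U \<and> insert v I \<notin> indep E U}"
  have T: "?T \<subseteq> indep E U"
    by (auto simp: indep_def)
  have eq: "indep E U = (?T \<union> insert v ` ?T) \<union> ?N"
  proof (intro equalityI subsetI)
    fix I assume I: "I \<in> indep E U"
    show "I \<in> (?T \<union> insert v ` ?T) \<union> ?N"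
    proof (cases "v \<in> I")
      case True
      then have "I - {v} \<in> ?T" "I = insert v (I - {v})" using I by (auto simp: insert_absorb)
      then show ?thesis by blast
    qed (use I in auto)
  qed (use T in auto)
  have fT: "finite ?T" and fN: "finite ?N"
    using assms by (auto intro: finite_subset[of _ "indep E U"])
  have "sum g (indep E U) = sum g ((?T \<union> insert v ` ?T) \<union> ?N)"
    using eq by simp
  also have "\<dots> = sum g (?T \<union> insert v ` ?T) + sum g ?N"
    using fT fN by (intro sum.union_disjoint) auto
  also have "sum g (?T \<union> insert v ` ?T) = sum g ?T + sum g (insert v ` ?T)"
    using fT by (intro sum.union_disjoint) auto
  also have "sum g (insert v ` ?T) = (\<Sum>K\<in>?T. g (insert v K))"
    by (subst sum.reindex) (auto simp: inj_on_def)
  finally show ?thesis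
    by (simp add: sum.distrib)
qed

text \<open>On a pair, both values are replaced by their mean with weights \<open>1\<close> and
  \<open>lam\<close>. This preserves the weighted sum, and the sum of squares drops by the variance
  within the pair, which is \<open>lam / (1 + lam)\<close> times the squared difference, up to the
  common factor \<open>lam ^ card K\<close>.\<close>

lemma
  assumes "finite U" "v \<in> U" "lam > 0"
  shows sum_site_update:
      "(\<Sum>I\<in>indep E U. lam ^ card I * site_update E lam U v f I)
        = (\<Sum>I\<in>indep E U. lam ^ card I * f I)"
    and sum_site_update_square:
      "(\<Sum>I\<in>indep E U. lam ^ card I * (site_update E lam U v f I)\<^sup>2)
        = (\<Sum>I\<in>indep E U. lam ^ card I * (f I)\<^sup>2)
          - lam / (1 + lam) * local_energy E lam U f v"
proof -
  let ?u = "site_update E lam U v f"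
  have l: "1 + lam \<noteq> 0" using assms(3) by simp
  have card: "lam ^ card (insert v K) = lam * lam ^ card K" "K - {v} = K"
    if "v \<notin> K" "insert v K \<in> indep E U" for K
    using that assms(1) finite_subset[of K U] by (auto simp: indep_def)
  have 1: "lam ^ card K * ?u K + lam ^ card (insert v K) * ?u (insert v K)
      = lam ^ card K * f K + lam ^ card (insert v K) * f (insert v K)"
    if "v \<notin> K \<and> insert v K \<in> indep E U" for K
  proof -
    define m where "m = (f K + lam * f (insert v K)) / (1 + lam)"
    have "(1 + lam) * m = f K + lam * f (insert v K)" using l by (simp add: m_def)
    then have "lam ^ card K * ((1 + lam) * m) = lam ^ card K * (f K + lam * f (insert v K))"
      by (rule arg_cong)
    moreover have "?u K = m" "?u (insert v K) = m"
      using that card[of K] by (auto simp: site_update_def m_def)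
    ultimately show ?thesis
      using that card[of K] by (simp add: algebra_simps)
  qed
  let ?T = "{K. v \<notin> K \<and> insert v K \<in> indep E U}"
  let ?N = "{I. v \<notin> I \<and> I \<in> indep E U \<and> insert v I \<notin> indep E U}"
  have "(\<Sum>K\<in>?T. lam ^ card K * ?u K + lam ^ card (insert v K) * ?u (insert v K))
      = (\<Sum>K\<in>?T. lam ^ card K * f K + lam ^ card (insert v K) * f (insert v K))"
    by (rule sum.cong) (use 1 in blast)+
  moreover have "(\<Sum>I\<in>?N. lam ^ card I * ?u I) = (\<Sum>I\<in>?N. lam ^ card I * f I)"
    by (rule sum.cong) (auto simp: site_update_def)
  ultimately show "(\<Sum>I\<in>indep E U. lam ^ card I * ?u I) = (\<Sum>I\<in>indep E U. lam ^ card I * f I)"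
    unfolding sum_indep_pairs[OF assms(1,2)] by simp
  have 2: "lam ^ card K * (?u K)\<^sup>2 + lam ^ card (insert v K) * (?u (insert v K))\<^sup>2
      = (lam ^ card K * (f K)\<^sup>2 + lam ^ card (insert v K) * (f (insert v K))\<^sup>2)
        - lam / (1 + lam) * (lam ^ card K * (f (insert v K) - f K)\<^sup>2)"
    if "v \<notin> K \<and> insert v K \<in> indep E U" for K
  proof -
    define m where "m = (f K + lam * f (insert v K)) / (1 + lam)"
    have m: "lam * f (insert v K) = (1 + lam) * m - f K" using l by (simp add: m_def)
    have "(1 + lam) * ((1 + lam) * m\<^sup>2) =
        (1 + lam) * ((f K)\<^sup>2 + lam * (f (insert v K))\<^sup>2) - lam * (f (insert v K) - f K)\<^sup>2"
      using m by algebra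
    then have "(1 + lam) * m\<^sup>2 =
        (f K)\<^sup>2 + lam * (f (insert v K))\<^sup>2 - lam / (1 + lam) * (f (insert v K) - f K)\<^sup>2"
      using l by (simp add: field_simps)
    then have "lam ^ card K * ((1 + lam) * m\<^sup>2) = lam ^ card K *
        ((f K)\<^sup>2 + lam * (f (insert v K))\<^sup>2 - lam / (1 + lam) * (f (insert v K) - f K)\<^sup>2)"
      by (rule arg_cong)
    moreover have "?u K = m" "?u (insert v K) = m"
      using that card[of K] by (auto simp: site_update_def m_def)
    ultimately show ?thesis
      using that card[of K] by (simp add: algebra_simps)
  qed
  show "(\<Sum>I\<in>indep E U. lam ^ card I * (?u I)\<^sup>2)
        = (\<Sum>I\<in>indep E U. lam ^ card I * (f I)\<^sup>2)
          - lam / (1 + lam) * local_energy E lam U f v"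
  proof -
    have "(\<Sum>K\<in>?T. lam ^ card K * (?u K)\<^sup>2 + lam ^ card (insert v K) * (?u (insert v K))\<^sup>2)
      = (\<Sum>K\<in>?T. (lam ^ card K * (f K)\<^sup>2 + lam ^ card (insert v K) * (f (insert v K))\<^sup>2)
        - lam / (1 + lam) * (lam ^ card K * (f (insert v K) - f K)\<^sup>2))"
      by (rule sum.cong) (use 2 in auto)
    also have "\<dots> = (\<Sum>K\<in>?T. lam ^ card K * (f K)\<^sup>2 + lam ^ card (insert v K) * (f (insert v K))\<^sup>2)
        - lam / (1 + lam) * local_energy E lam U f v"
      by (simp add: local_energy_def sum_subtractf sum_distrib_left)
    moreover have "(\<Sum>I\<in>?N. lam ^ card I * (?u I)\<^sup>2) = (\<Sum>I\<in>?N. lam ^ card I * (f I)\<^sup>2)"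
      by (rule sum.cong) (auto simp: site_update_def)
    ultimately show ?thesis
      unfolding sum_indep_pairs[OF assms(1,2)] by simp
  qed
qed

definition glauber_op ::
  "('a \<times> 'a) set \<Rightarrow> real \<Rightarrow> 'a set \<Rightarrow> ('a set \<Rightarrow> real) \<Rightarrow> 'a set \<Rightarrow> real" where
  "glauber_op E lam U f I = (\<Sum>v\<in>U. site_update E lam U v f I) / card U"

lemma sum_glauber_op:
  assumes "finite U" "U \<noteq> {}" "lam > 0"
  shows "(\<Sum>I\<in>indep E U. lam ^ card I * glauber_op E lam U f I)
    = (\<Sum>I\<in>indep E U. lam ^ card I * f I)"
proof -
  have "(\<Sum>I\<in>indep E U. lam ^ card I * glauber_op E lam U f I)
      = (\<Sum>v\<in>U. \<Sum>I\<in>indep E U. lam ^ card I * site_update E lam U v f I) / card U"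
    by (subst sum.swap) (simp add: glauber_op_def sum_distrib_left sum_divide_distrib)
  then show ?thesis
    using assms by (simp add: sum_site_update)
qed

definition weighted_mean ::
  "('a \<times> 'a) set \<Rightarrow> real \<Rightarrow> 'a set \<Rightarrow> ('a set \<Rightarrow> real) \<Rightarrow> real" where
  "weighted_mean E lam U f = (\<Sum>I\<in>indep E U. lam ^ card I * f I) / weight_sum E lam U"

definition weighted_variance ::
  "('a \<times> 'a) set \<Rightarrow> real \<Rightarrow> 'a set \<Rightarrow> ('a set \<Rightarrow> real) \<Rightarrow> real" where
  "weighted_variance E lam U f =
    (\<Sum>I\<in>indep E U. lam ^ card I * (f I - weighted_mean E lam U f)\<^sup>2)"

lemma weighted_mean_glauber_op:
  assumes "finite U" "U \<noteq> {}" "lam > 0"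
  shows "weighted_mean E lam U (glauber_op E lam U f) = weighted_mean E lam U f"
  using assms by (simp add: weighted_mean_def sum_glauber_op)

text \<open>
  The dynamics is an average of orthogonal projections, which makes the one-step decay of the
  variance at least the Dirichlet form, without any appeal to the spectrum.
\<close>

lemma weighted_variance_glauber_op_le:
  assumes "finite U" "U \<noteq> {}" "lam > 0"
  shows "weighted_variance E lam U (glauber_op E lam U f) \<le> weighted_variance E lam U f
    - lam / (1 + lam) / card U * (\<Sum>v\<in>U. local_energy E lam U f v)"
proof -
  define \<mu> where "\<mu> = weighted_mean E lam U f"
  let ?g = "\<lambda>I. f I - \<mu>"
  have n: "card U > 0" using assms by (simp add: card_gt_0_iff)
  \<comment> \<open>Updates fix constants, so \<open>f\<close> can be centred at its mean before
    squaring.\<close>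
  have upd: "site_update E lam U v f I - \<mu> = site_update E lam U v ?g I" for v I
  proof -
    have "\<mu> = (\<mu> + lam * \<mu>) / (1 + lam)" using assms(3) by (simp add: field_simps)
    then show ?thesis
      by (simp add: site_update_def algebra_simps add_divide_distrib diff_divide_distrib)
  qed
  have sq: "(glauber_op E lam U f I - \<mu>)\<^sup>2 \<le> (\<Sum>v\<in>U. (site_update E lam U v ?g I)\<^sup>2) / card U" for I
  proof -
    have "glauber_op E lam U f I - \<mu> = (\<Sum>v\<in>U. site_update E lam U v f I - \<mu>) / card U"
      using n by (simp add: glauber_op_def sum_subtractf diff_divide_distrib)
    also have "\<dots> = (\<Sum>v\<in>U. site_update E lam U v ?g I) / card U"
      by (simp add: upd)
    finally have "card U * (glauber_op E lam U f I - \<mu>)\<^sup>2 \<le> (\<Sum>v\<in>U. (site_update E lam U v ?g I)\<^sup>2)"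
      using weighted_mean_square_le[of "\<lambda>_. 1" U "\<lambda>v. site_update E lam U v ?g I"] n by simp
    then show ?thesis
      using n by (simp add: pos_le_divide_eq mult.commute)
  qed
  have "weighted_variance E lam U (glauber_op E lam U f)
      = (\<Sum>I\<in>indep E U. lam ^ card I * (glauber_op E lam U f I - \<mu>)\<^sup>2)"
    using assms by (simp add: weighted_variance_def weighted_mean_glauber_op \<mu>_def)
  also have "\<dots> \<le> (\<Sum>I\<in>indep E U. lam ^ card I * ((\<Sum>v\<in>U. (site_update E lam U v ?g I)\<^sup>2) / card U))"
    using assms(3) sq by (intro sum_mono mult_left_mono) auto
  also have "\<dots> = (\<Sum>v\<in>U. \<Sum>I\<in>indep E U. lam ^ card I * (site_update E lam U v ?g I)\<^sup>2) / card U"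
    by (subst sum.swap) (simp add: sum_distrib_left sum_divide_distrib)
  also have "\<dots> = (\<Sum>v\<in>U. weighted_variance E lam U f - lam / (1 + lam) * local_energy E lam U f v) / card U"
    using assms
    by (simp add: sum_site_update_square weighted_variance_def \<mu>_def local_energy_def)
  also have "\<dots> = weighted_variance E lam U f
      - lam / (1 + lam) / card U * (\<Sum>v\<in>U. local_energy E lam U f v)"
    using n by (simp add: sum_subtractf diff_divide_distrib sum_distrib_left[symmetric]
        sum_divide_distrib[symmetric])
  finally show ?thesis .
qed

lemma weighted_variance_glauber_op_contract:
  fixes \<gamma> :: real
  assumes "finite U" "U \<noteq> {}" "lam > 0" and P: "poincare E lam U \<gamma>" and "\<gamma> > 0"
  shows "weighted_variance E lam U (glauber_op E lam U f)
    \<le> (1 - lam / (1 + lam) / (card U * \<gamma>)) * weighted_variance E lam U f"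
proof -
  have "weighted_variance E lam U f \<le> \<gamma> * (\<Sum>v\<in>U. local_energy E lam U f v)"
    using poincare_mean[OF P assms(1,3)] by (simp add: weighted_variance_def weighted_mean_def)
  then have "lam / (1 + lam) / (card U * \<gamma>) * weighted_variance E lam U f
      \<le> lam / (1 + lam) / (card U * \<gamma>) * (\<gamma> * (\<Sum>v\<in>U. local_energy E lam U f v))"
    using assms by (intro mult_left_mono) auto
  also have "\<dots> = lam / (1 + lam) / card U * (\<Sum>v\<in>U. local_energy E lam U f v)"
    using \<open>\<gamma> > 0\<close> by simp
  finally show ?thesis
    using weighted_variance_glauber_op_le[OF assms(1-3), of E f] by (simp add: left_diff_distrib)
qed

lemma weighted_variance_glauber_op_funpow:
  fixes \<gamma> :: real
  assumes "finite U" "U \<noteq> {}" "lam > 0" and P: "poincare E lam U \<gamma>" and "\<gamma> \<ge> 1"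
  shows "weighted_variance E lam U ((glauber_op E lam U ^^ t) f)
    \<le> exp (- (t * (lam / (1 + lam) / (card U * \<gamma>)))) * weighted_variance E lam U f"
proof -
  define r where "r = lam / (1 + lam) / (card U * \<gamma>)"
  have V: "weighted_variance E lam U g \<ge> 0" for g
    unfolding weighted_variance_def using assms(3) by (intro sum_nonneg) simp
  have step: "weighted_variance E lam U (glauber_op E lam U g)
      \<le> exp (- r) * weighted_variance E lam U g" for g
  proof -
    have "weighted_variance E lam U (glauber_op E lam U g) \<le> (1 - r) * weighted_variance E lam U g"
      unfolding r_def using assms by (intro weighted_variance_glauber_op_contract) auto
    \<comment> \<open>The exponential is positive, so the one-step bounds can be multiplied whatever
      the sign of \<open>1 - r\<close>.\<close>
    also have "\<dots> \<le> exp (- r) * weighted_variance E lam U g"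
      using V exp_ge_add_one_self[of "- r"] by (intro mult_right_mono) auto
    finally show ?thesis .
  qed
  have "weighted_variance E lam U ((glauber_op E lam U ^^ t) f)
      \<le> exp (- (t * r)) * weighted_variance E lam U f"
  proof (induction t)
    case (Suc t)
    have "weighted_variance E lam U ((glauber_op E lam U ^^ Suc t) f)
        \<le> exp (- r) * weighted_variance E lam U ((glauber_op E lam U ^^ t) f)"
      using step by simp
    also have "\<dots> \<le> exp (- r) * (exp (- (t * r)) * weighted_variance E lam U f)"
      using Suc by (intro mult_left_mono) auto
    also have "\<dots> = exp (- (Suc t * r)) * weighted_variance E lam U f"
      by (simp add: exp_add[symmetric] algebra_simps)
    finally show ?case .
  qed simp
  then show ?thesis by (simp add: r_def)
qed

section \<open>Expectations along the Markov chain\<close>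

lemma finite_set_pmf_glauber_step:
  assumes "finite (pverts G)" "pverts G \<noteq> {}"
  shows "finite (set_pmf (glauber_step G lam I))"
  using assms by (auto simp: glauber_step_def set_pmf_of_set)

lemma set_pmf_glauber_step:
  assumes "finite (pverts G)" "pverts G \<noteq> {}" "I \<in> independent_sets G"
  shows "set_pmf (glauber_step G lam I) \<subseteq> independent_sets G"
  using assms(3) assms(1,2)
  by (auto simp: glauber_step_def set_pmf_of_set independent_sets_def split: if_splits)

lemma set_pmf_glauber_dist:
  assumes "finite (pverts G)" "pverts G \<noteq> {}" "I \<in> independent_sets G"
  shows "set_pmf (glauber_dist G lam t I) \<subseteq> independent_sets G"
proof (induction t)
  case (Suc t)
  then show ?case using set_pmf_glauber_step[OF assms(1,2)] by fastforce
qed (use assms in simp)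

lemma expectation_glauber_step:
  fixes f :: "'a set \<Rightarrow> real"
  assumes "finite (pverts G)" "pverts G \<noteq> {}" "lam > 0"
  shows "measure_pmf.expectation (glauber_step G lam I) f = glauber_op (parcs G) lam (pverts G) f I"
proof -
  let ?step = "\<lambda>v. if v \<in> I then
       map_pmf (\<lambda>r. if r then I - {v} else I) (bernoulli_pmf (1 / (lam + 1)))
     else if insert v I \<in> independent_sets G then
       map_pmf (\<lambda>r. if r then insert v I else I) (bernoulli_pmf (lam / (lam + 1)))
     else return_pmf I"
  have l: "0 \<le> 1 / (lam + 1)" "1 / (lam + 1) \<le> 1" "0 \<le> lam / (lam + 1)" "lam / (lam + 1) \<le> 1"
    using assms(3) by (auto simp: field_simps)
  have upd: "measure_pmf.expectation (?step v) f
      = site_update (parcs G) lam (pverts G) v f I" for v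
  proof -
    have compl: "1 - 1 / (lam + 1) = lam / (lam + 1)" "1 - lam / (lam + 1) = 1 / (lam + 1)"
      using assms(3) by (simp_all add: field_simps)
    have "x * (1 / (lam + 1)) + y * (1 - 1 / (lam + 1)) = (x + lam * y) / (1 + lam)"
      "x * (lam / (lam + 1)) + y * (1 - lam / (lam + 1)) = (y + lam * x) / (1 + lam)" for x y
      unfolding compl by (simp_all add: add_divide_distrib add.commute mult.commute)
    then show ?thesis
      using l by (simp add: site_update_def independent_sets_eq_indep del: times_divide_eq_right)
  qed
  have "measure_pmf.expectation (glauber_step G lam I) f
      = (\<Sum>v\<in>pverts G. measure_pmf.expectation (?step v) f /\<^sub>R real (card (pverts G)))"
    unfolding glauber_step_def using assms by (intro pmf_expectation_bind_pmf_of_set) auto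
  also have "\<dots> = (\<Sum>v\<in>pverts G. site_update (parcs G) lam (pverts G) v f I /\<^sub>R real (card (pverts G)))"
    by (simp only: upd)
  finally show ?thesis
    by (simp add: glauber_op_def sum_distrib_left[symmetric] divide_inverse mult.commute)
qed

text \<open>Since \<open>glauber_dist\<close> appends its step at the end, the last step replaces
  the observable by its image under \<open>glauber_op\<close>, seen from time \<open>t\<close>;
  hence the induction runs over all \<open>f\<close> at once.\<close>

lemma expectation_glauber_dist:
  fixes f :: "'a set \<Rightarrow> real"
  assumes "finite (pverts G)" "pverts G \<noteq> {}" "lam > 0" "I \<in> independent_sets G"
  shows "measure_pmf.expectation (glauber_dist G lam t I) f
    = (glauber_op (parcs G) lam (pverts G) ^^ t) f I"
proof (induction t arbitrary: f)
  case (Suc t)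
  have fin: "finite (independent_sets G)"
    using assms(1) by (simp add: independent_sets_eq_indep)
  note supp = set_pmf_glauber_dist[OF assms(1,2,4)]
  have "measure_pmf.expectation (glauber_dist G lam (Suc t) I) f
      = (\<Sum>J\<in>independent_sets G. pmf (glauber_dist G lam t I) J
          *\<^sub>R measure_pmf.expectation (glauber_step G lam J) f)"
    using fin supp finite_set_pmf_glauber_step[OF assms(1,2)]
    by (simp add: pmf_expectation_bind)
  also have "\<dots> = measure_pmf.expectation (glauber_dist G lam t I)
      (glauber_op (parcs G) lam (pverts G) f)"
    using supp by (subst integral_measure_pmf[OF fin]) (auto simp: expectation_glauber_step[OF assms(1-3)])
  also have "\<dots> = (glauber_op (parcs G) lam (pverts G) ^^ Suc t) f I"
    by (simp add: Suc funpow_swap1)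
  finally show ?case .
qed simp

lemma prob_hard_core_pmf:
  assumes "pair_graph G" "lam > 0"
  shows "measure_pmf.prob (hard_core_pmf G lam) A
    = weighted_mean (parcs G) lam (pverts G) (indicator A)"
proof -
  note fin = finite_independent_sets[OF assms(1)]
  have "measure_pmf.prob (hard_core_pmf G lam) A
      = measure_pmf.expectation (hard_core_pmf G lam) (indicator A)"
    by simp
  also have "\<dots> = (\<Sum>I\<in>independent_sets G. pmf (hard_core_pmf G lam) I *\<^sub>R indicator A I)"
    by (rule integral_measure_pmf[OF fin])
      (auto simp: set_pmf_iff pmf_hard_core_pmf[OF assms] split: if_splits)
  also have "\<dots> = weighted_mean (parcs G) lam (pverts G) (indicator A)"
    by (simp add: pmf_hard_core_pmf[OF assms] weighted_mean_def weight_sum_def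
        independent_sets_eq_indep partition_function_def sum_divide_distrib)
  finally show ?thesis .
qed

text \<open>A \<open>LEAST\<close> is at most any witness, and total variation is a supremum over
  events, so the closeness condition only concerns indicator observables.\<close>

lemma mixing_time_le:
  assumes "pair_graph G" "pverts G \<noteq> {}" "lam > 0"
    and close: "\<And>A I. I \<in> independent_sets G \<Longrightarrow>
      \<bar>(glauber_op (parcs G) lam (pverts G) ^^ t) (indicator A) I
        - weighted_mean (parcs G) lam (pverts G) (indicator A)\<bar> \<le> 1 / 4"
  shows "mixing_time G lam \<le> t"
  unfolding mixing_time_def
proof (rule Least_le, intro ballI)
  fix I assume I: "I \<in> independent_sets G"
  interpret pair_graph G by fact
  have "measure_pmf.prob (glauber_dist G lam t I) A
      = (glauber_op (parcs G) lam (pverts G) ^^ t) (indicator A) I" for A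
    using expectation_glauber_dist[OF pair_finite_verts assms(2,3) I, of t "indicator A"] by simp
  then show "tv_dist (glauber_dist G lam t I) (hard_core_pmf G lam) \<le> 1 / 4"
    unfolding tv_dist_def
    by (intro cSUP_least) (use close[OF I] prob_hard_core_pmf[OF assms(1,3)] in auto)
qed

section \<open>Worst-case starts and an explicit mixing time\<close>

lemma exp_abs_ln_bounds:
  fixes lam :: real
  assumes "lam > 0"
  shows "1 \<le> exp \<bar>ln lam\<bar>" "lam \<le> exp \<bar>ln lam\<bar>" "1 / lam \<le> exp \<bar>ln lam\<bar>"
proof -
  have "lam = exp (ln lam)" "1 / lam = exp (- ln lam)"
    using assms by (auto simp: exp_minus field_simps)
  then show "lam \<le> exp \<bar>ln lam\<bar>" "1 / lam \<le> exp \<bar>ln lam\<bar>"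
    by (metis abs_ge_self exp_le_cancel_iff, metis abs_ge_minus_self exp_le_cancel_iff)
qed simp

text \<open>This bounds the reciprocal of the stationary probability of \<open>I\<close>. There are
  at most \<open>2 ^ card U\<close> independent sets, each of weight at most
  \<open>exp \<bar>ln lam\<bar> ^ card U\<close>, and \<open>lam ^ card I\<close> is at least the
  reciprocal of that power. A spare \<open>2 ^ card U\<close> makes everything a power of a single
  base.\<close>

lemma weight_sum_le_weight:
  assumes "finite U" "lam > 0" "I \<in> indep E U"
  shows "weight_sum E lam U \<le> (2 * exp \<bar>ln lam\<bar>) ^ (2 * card U) * lam ^ card I"
proof -
  define L where "L = exp \<bar>ln lam\<bar>"
  note L = exp_abs_ln_bounds[OF assms(2), folded L_def]
  have card: "card J \<le> card U" if "J \<in> indep E U" for J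
    using that assms(1) by (auto simp: indep_def intro: card_mono)
  have "weight_sum E lam U \<le> (\<Sum>J\<in>indep E U. L ^ card U)"
    unfolding weight_sum_def
  proof (rule sum_mono)
    fix J assume J: "J \<in> indep E U"
    have "lam ^ card J \<le> L ^ card J" using L assms by (intro power_mono) auto
    also have "\<dots> \<le> L ^ card U" using L card[OF J] by (intro power_increasing) auto
    finally show "lam ^ card J \<le> L ^ card U" .
  qed
  also have "\<dots> = real (card (indep E U)) * L ^ card U" by simp
  also have "\<dots> \<le> 2 ^ card U * L ^ card U"
  proof (rule mult_right_mono)
    have "card (indep E U) \<le> card (Pow U)"
      by (rule card_mono) (use assms in \<open>auto simp: indep_def\<close>)
    then have "card (indep E U) \<le> 2 ^ card U" using assms(1) by (simp add: card_Pow)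
    then show "real (card (indep E U)) \<le> 2 ^ card U"
      by (metis of_nat_le_iff of_nat_numeral of_nat_power)
  qed (use L in simp)
  also have "\<dots> \<le> 2 ^ card U * L ^ card U * ((2 * L) ^ card U * lam ^ card I)"
  proof -
    have "(1 / lam) ^ card I \<le> L ^ card I" using L assms by (intro power_mono) auto
    also have "\<dots> \<le> L ^ card U" using L card[OF assms(3)] by (intro power_increasing) auto
    also have "\<dots> \<le> (2 * L) ^ card U" using L by (intro power_mono) auto
    finally have "1 \<le> (2 * L) ^ card U * lam ^ card I"
      using assms(2) by (simp add: power_divide field_simps)
    then have "2 ^ card U * L ^ card U * 1 \<le> 2 ^ card U * L ^ card U * ((2 * L) ^ card U * lam ^ card I)"
      using L by (intro mult_left_mono) auto
    then show ?thesis by simp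
  qed
  finally show ?thesis
    unfolding L_def mult_2[of "card U"] power_add by (simp add: power_mult_distrib mult_ac)
qed

text \<open>The squared deviation at \<open>I\<close>, times \<open>lam ^ card I\<close>, is one
  summand of the variance and so decays exponentially. The variance of an indicator is at most the
  total weight, hence at most \<open>(2 * L) ^ (2 * n) * lam ^ card I\<close>, and the weight of
  \<open>I\<close> cancels.\<close>

lemma mixing_time_le_poincare:
  assumes G: "pair_graph G" and ne: "pverts G \<noteq> {}" and lam: "lam > 0"
    and P: "poincare (parcs G) lam (pverts G) \<gamma>" and \<gamma>: "\<gamma> \<ge> 1"
  shows "real (mixing_time G lam) \<le> 8 * real (num_verts G) ^ 2 * (2 * exp \<bar>ln lam\<bar>)\<^sup>2 * \<gamma>"
proof -
  interpret pair_graph G by fact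
  define L where "L = exp \<bar>ln lam\<bar>"
  note L = exp_abs_ln_bounds[OF lam, folded L_def]
  define n where "n = num_verts G"
  have n: "n \<ge> 1" using ne pair_finite_verts by (simp add: n_def Suc_le_eq card_gt_0_iff)
  let ?E = "parcs G" and ?U = "pverts G"
  \<comment> \<open>The relaxation time, that is the reciprocal of the contraction rate. The time
    \<open>t\<close> below suffices to beat the worst-case factor \<open>(2 * L) ^ (2 * n)\<close>;
    the \<open>16\<close> is the threshold \<open>1 / 4\<close> squared and inverted.\<close>
  define \<rho> where "\<rho> = n * \<gamma> * ((1 + lam) / lam)"
  have \<rho>: "\<rho> > 0" unfolding \<rho>_def using n \<gamma> lam by (intro mult_pos_pos divide_pos_pos) auto
  define t where "t = nat \<lceil>\<rho> * ln (16 * (2 * L) ^ (2 * n))\<rceil>"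
  have t: "\<rho> * ln (16 * (2 * L) ^ (2 * n)) \<le> t"
    unfolding t_def by (rule real_nat_ceiling_ge)
  have "mixing_time G lam \<le> t"
  proof (rule mixing_time_le[OF G ne lam])
    fix A I assume I: "I \<in> independent_sets G"
    let ?f = "indicator A :: 'a set \<Rightarrow> real"
    let ?g = "(glauber_op ?E lam ?U ^^ t) ?f"
    define \<mu> where "\<mu> = weighted_mean ?E lam ?U ?f"
    have I': "I \<in> indep ?E ?U" using I by (simp add: independent_sets_eq_indep)
    have mean: "weighted_mean ?E lam ?U ?g = \<mu>"
      by (induction t) (auto simp: weighted_mean_glauber_op[OF pair_finite_verts ne lam] \<mu>_def)
    have wp: "lam ^ card I > 0" using lam by simp
    have "lam ^ card I * (?g I - \<mu>)\<^sup>2 \<le> weighted_variance ?E lam ?U ?g"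
      unfolding weighted_variance_def mean
      by (rule member_le_sum[OF I']) (use lam pair_finite_verts in auto)
    also have "\<dots> \<le> exp (- (t * (lam / (1 + lam) / (n * \<gamma>)))) * weighted_variance ?E lam ?U ?f"
      unfolding n_def by (rule weighted_variance_glauber_op_funpow[OF pair_finite_verts ne lam P \<gamma>])
    also have "t * (lam / (1 + lam) / (n * \<gamma>)) = t / \<rho>"
      by (simp add: \<rho>_def)
    also have "exp (- (t / \<rho>)) * weighted_variance ?E lam ?U ?f
        \<le> 1 / (16 * (2 * L) ^ (2 * n)) * ((2 * L) ^ (2 * n) * lam ^ card I)"
    proof (rule mult_mono)
      have "ln (16 * (2 * L) ^ (2 * n)) \<le> t / \<rho>"
        using t \<rho> by (simp add: pos_le_divide_eq mult.commute)
      then have "exp (ln (16 * (2 * L) ^ (2 * n))) \<le> exp (t / \<rho>)" by simp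
      then have "16 * (2 * L) ^ (2 * n) \<le> exp (t / \<rho>)" using L by simp
      then show "exp (- (t / \<rho>)) \<le> 1 / (16 * (2 * L) ^ (2 * n))"
        using L by (simp add: exp_minus inverse_eq_divide frac_le)
      have Z: "weight_sum ?E lam ?U > 0" using weight_sum_pos pair_finite_verts lam by blast
      have "0 \<le> \<mu>" unfolding \<mu>_def weighted_mean_def using Z lam
        by (intro divide_nonneg_nonneg sum_nonneg) auto
      moreover have "(\<Sum>I\<in>indep ?E ?U. lam ^ card I * ?f I) \<le> weight_sum ?E lam ?U"
        unfolding weight_sum_def using lam by (intro sum_mono) (auto simp: indicator_def)
      then have "\<mu> \<le> 1" unfolding \<mu>_def weighted_mean_def using Z by simp
      ultimately have "(?f J - \<mu>)\<^sup>2 \<le> 1" for J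
        by (subst abs_square_le_1) (auto simp: indicator_def)
      then have "weighted_variance ?E lam ?U ?f \<le> weight_sum ?E lam ?U"
        unfolding weighted_variance_def weight_sum_def \<mu>_def[symmetric]
        using lam by (intro sum_mono) (simp add: mult_left_le)
      also have "\<dots> \<le> (2 * L) ^ (2 * n) * lam ^ card I"
        unfolding L_def n_def by (rule weight_sum_le_weight[OF pair_finite_verts lam I'])
      finally show "weighted_variance ?E lam ?U ?f \<le> (2 * L) ^ (2 * n) * lam ^ card I" .
    qed (use L lam in \<open>auto simp: weighted_variance_def intro!: sum_nonneg\<close>)
    also have "\<dots> = lam ^ card I * (1 / 4)\<^sup>2"
      using L by (simp add: power2_eq_square)
    finally have "(?g I - \<mu>)\<^sup>2 \<le> (1 / 4)\<^sup>2"
      using wp by (simp del: power_divide)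
    then show "\<bar>?g I - weighted_mean ?E lam ?U ?f\<bar> \<le> 1 / 4"
      unfolding \<mu>_def[symmetric] using abs_le_square_iff[of "?g I - \<mu>" "1/4"] by simp
  qed
  then have "real (mixing_time G lam) \<le> real t" by simp
  also have "real t \<le> \<rho> * ln (16 * (2 * L) ^ (2 * n)) + 1"
  proof -
    have "1 \<le> (2 * L) ^ (2 * n)" using L by (intro one_le_power) simp
    then have "0 \<le> \<rho> * ln (16 * (2 * L) ^ (2 * n))"
      using \<rho> by (intro mult_nonneg_nonneg ln_ge_zero) auto
    then show ?thesis unfolding t_def by linarith
  qed
  \<comment> \<open>One factor \<open>2 * L\<close> bounds
    \<open>(1 + lam) / lam = 1 + 1 / lam\<close>, the other bounds \<open>ln (2 * L)\<close>; the
    summand \<open>4\<close> comes from \<open>16 \<le> (2 * L) ^ 4\<close>.\<close>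
  also have "\<dots> \<le> (n * \<gamma> * (2 * L)) * ((4 + 2 * n) * (2 * L)) + 1"
  proof (intro add_right_mono mult_mono)
    have "(1 + lam) / lam = 1 + 1 / lam" using lam by (simp add: field_simps)
    also have "\<dots> \<le> 2 * L" using L by simp
    finally show "\<rho> \<le> n * \<gamma> * (2 * L)"
      unfolding \<rho>_def using n \<gamma> by (intro mult_left_mono) auto
    have "16 \<le> (2 * L) ^ 4" using L power_mono[of 2 "2 * L" 4] by simp
    then have "16 * (2 * L) ^ (2 * n) \<le> (2 * L) ^ 4 * (2 * L) ^ (2 * n)"
      using L by (intro mult_right_mono) auto
    also have "\<dots> = (2 * L) ^ (4 + 2 * n)" by (simp add: power_add)
    finally have "ln (16 * (2 * L) ^ (2 * n)) \<le> ln ((2 * L) ^ (4 + 2 * n))"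
      using L by (subst ln_le_cancel_iff) auto
    also have "\<dots> = (4 + 2 * n) * ln (2 * L)" using L by (subst ln_realpow) auto
    also have "\<dots> \<le> (4 + 2 * n) * (2 * L)"
      using L ln_le_minus_one[of "2 * L"] by (intro mult_left_mono) auto
    finally show "ln (16 * (2 * L) ^ (2 * n)) \<le> (4 + 2 * n) * (2 * L)" .
    have "1 \<le> (2 * L) ^ (2 * n)" using L by (intro one_le_power) simp
    then show "0 \<le> ln (16 * (2 * L) ^ (2 * n))" by (intro ln_ge_zero) auto
  qed (use L n \<gamma> in auto)
  also have "\<dots> \<le> (n * \<gamma> * (2 * L)) * ((4 + 2 * n) * (2 * L)) + (2 * L)\<^sup>2 * \<gamma>"
  proof -
    have "1 * 1 \<le> (2 * L)\<^sup>2 * \<gamma>"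
      using L \<gamma> by (intro mult_mono one_le_power) auto
    then show ?thesis by simp
  qed
  also have "\<dots> = (real n * (4 + 2 * real n) + 1) * ((2 * L)\<^sup>2 * \<gamma>)"
    by (simp add: power2_eq_square algebra_simps)
  \<comment> \<open>For \<open>n \<ge> 1\<close> the coefficients \<open>2\<close>, \<open>4\<close>
    and \<open>1\<close> add up to \<open>7\<close>; rounding up to \<open>8 = 2 ^ 3\<close> lets
    the factor become a power of \<open>2\<close> in the final estimate.\<close>
  also have "\<dots> \<le> (8 * real n ^ 2) * ((2 * L)\<^sup>2 * \<gamma>)"
  proof (rule mult_right_mono)
    have "1 * real n \<le> real n * real n" "1 * 1 \<le> real n * real n"
      using n by (intro mult_mono; simp)+
    then show "real n * (4 + 2 * real n) + 1 \<le> 8 * real n ^ 2"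
      by (simp add: power2_eq_square algebra_simps)
  qed (use \<gamma> in simp)
  finally show ?thesis by (simp add: n_def L_def mult.assoc)
qed

text \<open>With a single vertex the update resamples the whole configuration, so one step reaches
  equilibrium exactly. The claimed bound is then \<open>1\<close>, which the general estimate
  exceeds.\<close>

lemma mixing_time_single_vertex:
  assumes G: "pair_graph G" and card: "num_verts G = 1" and lam: "lam > 0"
  shows "mixing_time G lam \<le> 1"
proof -
  interpret pair_graph G by fact
  obtain v where U: "pverts G = {v}" using card by (auto simp: card_1_singleton_iff)
  have "(v, v) \<notin> parcs G" using pair_no_loops by force
  then have \<Omega>: "indep (parcs G) {v} = {{}, {v}}" by (auto simp: indep_def)
  have mean: "weighted_mean (parcs G) lam {v} f = (f {} + lam * f {v}) / (1 + lam)" for f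
    by (simp add: weighted_mean_def weight_sum_def \<Omega>)
  show ?thesis
  proof (rule mixing_time_le[OF G _ lam])
    fix A :: "'a set set" and I
    assume "I \<in> independent_sets G"
    then have "I = {} \<or> I = {v}" using \<Omega> U by (simp add: independent_sets_eq_indep)
    then show "\<bar>(glauber_op (parcs G) lam (pverts G) ^^ 1) (indicator A) I
        - weighted_mean (parcs G) lam (pverts G) (indicator A)\<bar> \<le> 1 / 4"
      using \<Omega> U
      by (auto simp: glauber_op_def site_update_def mean)
  qed (use U in simp)
qed


section \<open>Recursion over clique-based separators\<close>

text \<open>With \<open>L = exp \<bar>ln lam\<bar>\<close>, the factor
  \<open>1 + 2 * lam * card C\<close> is at most \<open>2 * L * (card C + 1)\<close>. Writing
  \<open>card C + 1\<close> as a power of \<open>2\<close> and enlarging the base to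
  \<open>2 * L\<close> gives the exponent \<open>1 + log 2 (card C + 1)\<close>. For a nonempty
  clique the logarithm is at least \<open>1\<close>, so doubling it absorbs the \<open>1\<close>; an
  empty clique costs nothing.\<close>

lemma poincare_remove_clique:
  assumes "finite U" "C \<subseteq> U" "\<And>u v. u \<in> C \<Longrightarrow> v \<in> C \<Longrightarrow> u \<noteq> v \<Longrightarrow> (u, v) \<in> E"
    and P: "poincare E lam (U - C) \<gamma>" and \<gamma>: "\<gamma> \<ge> 1" and lam: "lam > 0"
  shows "poincare E lam U ((2 * exp \<bar>ln lam\<bar>) powr (2 * log 2 (real (card C) + 1)) * \<gamma>)"
proof (cases "C = {}")
  case True
  then show ?thesis using P by simp
next
  case False
  define L where "L = exp \<bar>ln lam\<bar>"
  note L = exp_abs_ln_bounds[OF lam, folded L_def]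
  have "card C > 0" using False assms(1,2) finite_subset by (auto simp: card_gt_0_iff)
  then have k: "1 \<le> log 2 (real (card C) + 1)" by (subst le_log_iff) auto
  have "1 + 2 * lam * card C \<le> 2 * L * (real (card C) + 1)"
    using L mult_right_mono[OF L(2), of "real (card C)"] by (simp add: algebra_simps)
  also have "\<dots> = (2 * L) powr 1 * 2 powr log 2 (real (card C) + 1)"
    using L by simp
  also have "\<dots> \<le> (2 * L) powr 1 * (2 * L) powr log 2 (real (card C) + 1)"
    using L k by (intro mult_left_mono powr_mono2) auto
  also have "\<dots> \<le> (2 * L) powr (2 * log 2 (real (card C) + 1))"
    unfolding powr_add[symmetric] using L k by (intro powr_mono) auto
  finally have "(1 + 2 * lam * card C) * \<gamma> \<le> (2 * L) powr (2 * log 2 (real (card C) + 1)) * \<gamma>"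
    using \<gamma> by (intro mult_right_mono) auto
  then show ?thesis
    using poincare_mono[OF poincare_clique[OF assms] _ lam] unfolding L_def by blast
qed

text \<open>The cliques may overlap, so once one is removed the others can stick out of the
  remaining vertex set. What is really removed is the clique \<open>K j \<inter> U\<close>, whose
  weight is at most that of \<open>K j\<close>.\<close>

lemma poincare_remove_cliques:
  assumes "finite J" "finite U" "\<And>i. i \<in> J \<Longrightarrow> finite (K i)"
    and "\<And>i u v. i \<in> J \<Longrightarrow> u \<in> K i \<Longrightarrow> v \<in> K i \<Longrightarrow> u \<noteq> v \<Longrightarrow> (u, v) \<in> E"
    and "poincare E lam (U - (\<Union>i\<in>J. K i)) \<gamma>" and \<gamma>: "\<gamma> \<ge> 1" and lam: "lam > 0"
  shows "poincare E lam U
    ((2 * exp \<bar>ln lam\<bar>) powr (2 * (\<Sum>i\<in>J. log 2 (real (card (K i)) + 1))) * \<gamma>)"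
  using assms(1-5)
proof (induction J arbitrary: U rule: finite_induct)
  case empty
  then show ?case by simp
next
  case (insert j J)
  define L where "L = exp \<bar>ln lam\<bar>"
  note L = exp_abs_ln_bounds[OF lam, folded L_def]
  let ?l = "\<lambda>i. log 2 (real (card (K i)) + 1)"
  define \<gamma>' where "\<gamma>' = (2 * L) powr (2 * (\<Sum>i\<in>J. ?l i)) * \<gamma>"
  have sum: "0 \<le> (\<Sum>i\<in>J. ?l i)" by (intro sum_nonneg) simp
  then have "1 * 1 \<le> \<gamma>'"
    unfolding \<gamma>'_def using L \<gamma> by (intro mult_mono ge_one_powr_ge_zero) auto
  then have \<gamma>': "1 \<le> \<gamma>'" by simp
  have "U - (\<Union>i\<in>insert j J. K i) = (U - K j) - (\<Union>i\<in>J. K i)" by auto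
  then have R: "poincare E lam ((U - K j) - (\<Union>i\<in>J. K i)) \<gamma>"
    using insert.prems(4) by metis
  have "poincare E lam (U - K j) \<gamma>'"
    unfolding \<gamma>'_def L_def
  proof (rule insert.IH[OF _ _ _ R])
    show "(u, v) \<in> E" if "i \<in> J" "u \<in> K i" "v \<in> K i" "u \<noteq> v" for i u v
      using insert.prems(3)[OF insertI2] that .
  qed (use insert.prems in auto)
  moreover have "U - K j = U - (K j \<inter> U)" by auto
  ultimately have "poincare E lam U ((2 * L) powr (2 * log 2 (real (card (K j \<inter> U)) + 1)) * \<gamma>')"
    unfolding L_def
  proof (intro poincare_remove_clique)
    show "(u, v) \<in> E" if "u \<in> K j \<inter> U" "v \<in> K j \<inter> U" "u \<noteq> v" for u v
      using insert.prems(3)[OF insertI1] that by blast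
  qed (use insert.prems(1) \<gamma>' lam in auto)
  moreover have "(2 * L) powr (2 * log 2 (real (card (K j \<inter> U)) + 1)) * \<gamma>' \<le> (2 * L) powr (2 * ?l j) * \<gamma>'"
  proof (intro mult_right_mono powr_mono mult_left_mono)
    have "card (K j \<inter> U) \<le> card (K j)" using insert.prems(2) by (intro card_mono) auto
    then show "log 2 (real (card (K j \<inter> U)) + 1) \<le> ?l j" by simp
  qed (use L \<gamma>' in auto)
  moreover have "(2 * L) powr (2 * ?l j) * \<gamma>' = (2 * L) powr (2 * (\<Sum>i\<in>insert j J. ?l i)) * \<gamma>"
    using insert.hyps by (simp add: \<gamma>'_def powr_add distrib_left)
  ultimately have "poincare E lam U ((2 * L) powr (2 * (\<Sum>i\<in>insert j J. ?l i)) * \<gamma>)"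
    using poincare_mono[OF _ _ lam] by (simp only:)
  then show ?case
    by (simp only: L_def)
qed

lemma poincare_separation:
  assumes G: "pair_graph G" and sep: "clique_based_separation a w G A B S"
    and PA: "poincare (parcs G) lam A \<gamma>" and PB: "poincare (parcs G) lam B \<gamma>"
    and \<gamma>: "\<gamma> \<ge> 1" and lam: "lam > 0"
  shows "poincare (parcs G) lam (pverts G) ((2 * exp \<bar>ln lam\<bar>) powr (2 * w) * \<gamma>)"
proof -
  interpret pair_graph G by fact
  have AB: "A \<union> B \<union> S = pverts G" "A \<inter> B = {}" "A \<inter> S = {}" "B \<inter> S = {}"
      "\<forall>u\<in>A. \<forall>v\<in>B. (u, v) \<notin> parcs G"
    and "\<exists>(k::nat) K. k \<ge> 1 \<and> (\<forall>i\<in>{1..k}. is_clique G (K i)) \<and> S = (\<Union>i\<in>{1..k}. K i)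
      \<and> (\<Sum>i=1..k. log 2 (real (card (K i)) + 1)) \<le> w"
    using sep unfolding clique_based_separation_def by simp_all
  then obtain k :: nat and K where K: "\<forall>i\<in>{1..k}. is_clique G (K i)" "S = (\<Union>i\<in>{1..k}. K i)"
      "(\<Sum>i=1..k. log 2 (real (card (K i)) + 1)) \<le> w"
    by (elim exE conjE) (rule that)
  have fin: "finite A" "finite B"
    using AB(1) pair_finite_verts by (metis finite_Un)+
  have "(v, u) \<notin> parcs G" if "u \<in> A" "v \<in> B" for u v
    using AB(5) that pair_sym_arcs by (auto simp: symmetric_def dest: symD)
  then have "poincare (parcs G) lam (A \<union> B) \<gamma>"
    using AB fin PA PB \<gamma> lam by (intro poincare_Un) auto
  moreover have "A \<union> B = pverts G - (\<Union>i\<in>{1..k}. K i)"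
    using AB K(2) by auto
  moreover have "finite (K i)" if "i \<in> {1..k}" for i
    using bspec[OF K(1) that] pair_finite_verts by (auto simp: is_clique_def intro: finite_subset)
  ultimately have "poincare (parcs G) lam (pverts G)
      ((2 * exp \<bar>ln lam\<bar>) powr (2 * (\<Sum>i=1..k. log 2 (real (card (K i)) + 1))) * \<gamma>)"
    using K(1) \<gamma> lam pair_finite_verts
    by (intro poincare_remove_cliques) (auto simp: is_clique_def)
  moreover have "(2 * exp \<bar>ln lam\<bar>) powr (2 * (\<Sum>i=1..k. log 2 (real (card (K i)) + 1))) * \<gamma>
      \<le> (2 * exp \<bar>ln lam\<bar>) powr (2 * w) * \<gamma>"
  proof (intro mult_right_mono powr_mono)
    show "1 \<le> 2 * exp \<bar>ln lam\<bar>" using exp_abs_ln_bounds(1)[OF lam] by linarith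
  qed (use K(3) \<gamma> in auto)
  ultimately show ?thesis
    by (rule poincare_mono[OF _ _ lam])
qed

section \<open>Induced subgraphs and the induction over the class\<close>

lemma indep_restrict: "indep (E \<inter> A \<times> A) A = indep E A"
  by (auto simp: indep_def)

text \<open>The induction hypothesis speaks of the induced subgraph with its own arcs, the
  separation lemma of a part under the arcs of the whole graph. Independence within \<open>A\<close>
  only sees arcs inside \<open>A\<close>.\<close>

lemma poincare_restrict: "poincare (E \<inter> A \<times> A) lam A \<gamma> \<longleftrightarrow> poincare E lam A \<gamma>"
  by (simp add: poincare_def local_energy_def indep_restrict)

lemma hereditary_restrict:
  assumes "graph_class \<C>" "hereditary \<C>" "G \<in> \<C>" "A \<subseteq> pverts G"
  shows "\<lparr>pverts = A, parcs = parcs G \<inter> A \<times> A\<rparr> \<in> \<C>"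
proof -
  let ?H = "\<lparr>pverts = A, parcs = parcs G \<inter> A \<times> A\<rparr>"
  interpret pair_graph G using assms by (auto simp: graph_class_def)
  have "pair_wf_digraph ?H" by unfold_locales auto
  then have "wf_digraph (with_proj ?H)" by (simp add: wf_digraph_wp_iff)
  moreover have "wf_digraph (with_proj G)" by (simp add: wf_digraph_wp_iff pair_wf_digraph_axioms)
  ultimately have "induced_subgraph (with_proj ?H) (with_proj G)"
    using assms(4) by (auto simp: induced_subgraph_def subgraph_def compatible_def)
  then show ?thesis using assms unfolding hereditary_def by blast
qed

text \<open>Both parts of a separation share one constant, so \<open>h\<close> only has to satisfy a
  one-branch recursion, for every part size \<open>m\<close> that the balance condition admits. The
  bound \<open>h n \<ge> 2\<close> pays for a single vertex, a clique of weight \<open>1\<close>,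
  and keeps the constants at least \<open>1\<close>.\<close>

lemma poincare_hereditary:
  fixes w h :: "nat \<Rightarrow> real"
  assumes \<C>: "graph_class \<C>" "hereditary \<C>" and a: "a < 1" and lam: "lam > 0"
    and sep: "\<And>G. G \<in> \<C> \<Longrightarrow> num_verts G \<ge> 2 \<Longrightarrow> \<exists>S. clique_based_separator a (w (num_verts G)) G S"
    and h: "\<And>n. h n \<ge> 2"
      "\<And>m n. n \<ge> 2 \<Longrightarrow> real m \<le> a * real n \<Longrightarrow> 2 * w n + h m \<le> h n"
    and "G \<in> \<C>"
  shows "poincare (parcs G) lam (pverts G) ((2 * exp \<bar>ln lam\<bar>) powr h (num_verts G))"
  using \<open>G \<in> \<C>\<close>
proof (induction "num_verts G" arbitrary: G rule: less_induct)
  case less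
  interpret pair_graph G using less.prems \<C> by (auto simp: graph_class_def)
  define L where "L = exp \<bar>ln lam\<bar>"
  note L = exp_abs_ln_bounds[OF lam, folded L_def]
  let ?n = "num_verts G"
  consider "?n = 0" | "?n = 1" | "?n \<ge> 2" by linarith
  then show ?case
  proof cases
    case 1
    then have "pverts G = {}" using pair_finite_verts by simp
    then show ?thesis using poincare_empty by metis
  next
    case 2
    then obtain v where v: "pverts G = {v}" by (auto simp: card_1_singleton_iff)
    have "poincare (parcs G) lam {v} ((2 * L) powr (2 * log 2 (real (card {v}) + 1)) * 1)"
      unfolding L_def using lam by (intro poincare_remove_clique) (auto intro: poincare_empty)
    then have "poincare (parcs G) lam (pverts G) ((2 * L) powr 2)"
      by (simp add: v)
    moreover have "(2 * L) powr 2 \<le> (2 * L) powr h ?n"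
      using L h by (intro powr_mono) auto
    ultimately show ?thesis
      unfolding L_def using lam poincare_mono by metis
  next
    case 3
    then obtain A B S where S: "clique_based_separation a (w ?n) G A B S"
      using sep[OF less.prems] by (auto simp: clique_based_separator_def)
    \<comment> \<open>The exponent left after paying for the separator; the recursion for
      \<open>h\<close> makes it sufficient for either part.\<close>
    define \<gamma> where "\<gamma> = (2 * L) powr (h ?n - 2 * w ?n)"
    have part: "poincare (parcs G) lam D \<gamma> \<and> 1 \<le> \<gamma>" if "D = A \<or> D = B" for D
    proof -
      let ?H = "\<lparr>pverts = D, parcs = parcs G \<inter> D \<times> D\<rparr>"
      have sub: "D \<subseteq> pverts G" and card: "real (card D) \<le> a * real ?n"
        using S that unfolding clique_based_separation_def by auto
      have "a * real ?n < 1 * real ?n" using a 3 by (intro mult_strict_right_mono) auto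
      then have "card D < ?n" using card by simp
      then have "poincare (parcs G \<inter> D \<times> D) lam D ((2 * L) powr h (card D))"
        using less.hyps[of ?H] hereditary_restrict[OF \<C> less.prems sub] by (simp add: L_def)
      then have "poincare (parcs G) lam D ((2 * L) powr h (card D))"
        by (simp add: poincare_restrict)
      moreover have hD: "h (card D) \<le> h ?n - 2 * w ?n"
        using h(2)[OF 3 card] by simp
      then have "(2 * L) powr h (card D) \<le> \<gamma>"
        unfolding \<gamma>_def using L by (intro powr_mono) auto
      moreover have "1 \<le> \<gamma>"
        unfolding \<gamma>_def using L hD h(1)[of "card D"] by (intro ge_one_powr_ge_zero) auto
      ultimately show ?thesis
        using lam poincare_mono by metis
    qed
    have "poincare (parcs G) lam (pverts G) ((2 * L) powr (2 * w ?n) * \<gamma>)"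
      unfolding L_def using part lam by (intro poincare_separation[OF pair_graph_axioms S]) auto
    moreover have "(2 * L) powr (2 * w ?n) * \<gamma> = (2 * L) powr h ?n"
      by (simp add: \<gamma>_def powr_add[symmetric])
    ultimately show ?thesis
      by (simp add: L_def)
  qed
qed


section \<open>Solving the recursion\<close>

text \<open>For \<open>\<delta> < 0\<close> the function can decrease, but only by a bounded factor.
  With \<open>d = - \<delta>\<close>, the task is to bound \<open>(ln y / ln x) powr d\<close> by a
  multiple of \<open>(y / x) powr \<epsilon>\<close>; in \<open>z = ln y - ln x\<close> this sets a
  power of a linear function against an exponential. The restriction \<open>x \<ge> 2\<close> keeps
  \<open>ln x\<close> away from \<open>0\<close>.\<close>

lemma powr_ln_powr_almost_mono:
  fixes \<epsilon> \<delta> :: real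
  assumes "\<epsilon> > 0"
  obtains K where "K > 0"
    "\<And>x y. 2 \<le> x \<Longrightarrow> x \<le> y \<Longrightarrow> x powr \<epsilon> * ln x powr \<delta> \<le> K * (y powr \<epsilon> * ln y powr \<delta>)"
proof (cases "\<delta> \<ge> 0")
  case True
  have "x powr \<epsilon> * ln x powr \<delta> \<le> 1 * (y powr \<epsilon> * ln y powr \<delta>)" if "2 \<le> x" "x \<le> y" for x y
    using that True assms by (auto intro!: mult_mono powr_mono2)
  then show ?thesis using that[of 1] by simp
next
  case False
  define d where "d = - \<delta>"
  have d: "d > 0" using False by (simp add: d_def)
  \<comment> \<open>Chosen so that \<open>exp (\<eta> * z) powr d = exp (\<epsilon> * z)\<close>;
    the constant \<open>c\<close> below makes \<open>c * (1 + \<eta> * z)\<close> dominate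
    \<open>1 + z / ln 2\<close>.\<close>
  define \<eta> where "\<eta> = \<epsilon> / d"
  have \<eta>: "\<eta> > 0" using assms d by (simp add: \<eta>_def)
  define c where "c = max 1 (1 / (\<eta> * ln 2))"
  have c: "c \<ge> 1" "1 / ln 2 \<le> c * \<eta>"
    using \<eta> by (auto simp: c_def max_def field_simps)
  have "x powr \<epsilon> * ln x powr \<delta> \<le> c powr d * (y powr \<epsilon> * ln y powr \<delta>)" if xy: "2 \<le> x" "x \<le> y" for x y
  proof -
    have lx: "ln x \<ge> ln 2" "ln 2 > (0::real)" using xy by auto
    then have l: "ln x > 0" "ln y > 0" "ln x \<le> ln y" using xy by (auto intro: less_le_trans)
    define z where "z = ln y - ln x"
    have z: "z \<ge> 0" using l by (simp add: z_def)
    have "ln y / ln x = 1 + z / ln x" using l by (simp add: z_def field_simps)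
    also have "z / ln x \<le> z / ln 2" using z lx l by (intro divide_left_mono) auto
    also have "1 + z / ln 2 \<le> c + c * \<eta> * z"
      using c mult_right_mono[OF c(2) z] by simp
    also have "\<dots> = c * (1 + \<eta> * z)" by (simp add: algebra_simps)
    also have "\<dots> \<le> c * exp (\<eta> * z)"
      using c exp_ge_add_one_self[of "\<eta> * z"] by (intro mult_left_mono) auto
    finally have "(ln y / ln x) powr d \<le> (c * exp (\<eta> * z)) powr d"
      using l d by (intro powr_mono2) auto
    also have "\<dots> = c powr d * exp (\<epsilon> * z)"
      using c d by (simp add: powr_mult exp_powr_real \<eta>_def)
    also have "exp (\<epsilon> * z) = y powr \<epsilon> / x powr \<epsilon>"
      using xy by (simp add: powr_def z_def exp_diff[symmetric] algebra_simps)
    finally have "ln y powr d / ln x powr d \<le> c powr d * (y powr \<epsilon> / x powr \<epsilon>)"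
      using l by (simp add: powr_divide)
    then have "x powr \<epsilon> / ln x powr d \<le> c powr d * (y powr \<epsilon> / ln y powr d)"
      using l xy by (simp add: field_simps)
    then show ?thesis
      by (simp add: d_def powr_minus_divide)
  qed
  then show ?thesis using that[of "c powr d"] c by simp
qed

text \<open>Half of the power dominates \<open>1 + ln x\<close>. The other half, together with the
  logarithmic factor, is almost monotone and so stays above a positive multiple of its value at
  \<open>2\<close>. This lets the final exponent absorb constants and multiples of
  \<open>ln n\<close>.\<close>

lemma powr_ln_powr_lower_bound:
  fixes s \<delta> :: real
  assumes "s > 0"
  obtains K where "K > 0" "\<And>x. 2 \<le> x \<Longrightarrow> 1 + ln x \<le> K * (x powr s * ln x powr \<delta>)"
proof -
  define \<epsilon> where "\<epsilon> = s / 2"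
  have \<epsilon>: "\<epsilon> > 0" using assms by (simp add: \<epsilon>_def)
  have powr_s: "x powr s = x powr \<epsilon> * x powr \<epsilon>" for x :: real
    by (simp add: \<epsilon>_def powr_add[symmetric])
  obtain K where K: "K > 0"
    "\<And>x y. 2 \<le> x \<Longrightarrow> x \<le> y \<Longrightarrow> x powr \<epsilon> * ln x powr \<delta> \<le> K * (y powr \<epsilon> * ln y powr \<delta>)"
    using powr_ln_powr_almost_mono[OF \<epsilon>] by metis
  define \<kappa> where "\<kappa> = 2 powr \<epsilon> * ln 2 powr \<delta>"
  have \<kappa>: "\<kappa> > 0" by (simp add: \<kappa>_def)
  have "1 + ln x \<le> (1 + 1 / \<epsilon>) * K / \<kappa> * (x powr s * ln x powr \<delta>)" if x: "2 \<le> x" for x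
  proof -
    have "1 \<le> x powr \<epsilon>" using x \<epsilon> by (intro ge_one_powr_ge_zero) auto
    moreover have "\<epsilon> * ln x \<le> x powr \<epsilon>"
      using x ln_le_minus_one[of "x powr \<epsilon>"] by (simp add: ln_powr)
    then have "ln x \<le> 1 / \<epsilon> * x powr \<epsilon>" using \<epsilon> by (simp add: field_simps)
    ultimately have "1 + ln x \<le> (1 + 1 / \<epsilon>) * x powr \<epsilon>" by (simp add: distrib_right)
    also have "\<dots> \<le> (1 + 1 / \<epsilon>) * (x powr \<epsilon> * (K / \<kappa> * (x powr \<epsilon> * ln x powr \<delta>)))"
    proof -
      have "1 \<le> K / \<kappa> * (x powr \<epsilon> * ln x powr \<delta>)"
        using K(2)[of 2 x] x \<kappa> by (simp add: \<kappa>_def[symmetric] field_simps)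
      then have "x powr \<epsilon> * 1 \<le> x powr \<epsilon> * (K / \<kappa> * (x powr \<epsilon> * ln x powr \<delta>))"
        by (intro mult_left_mono) auto
      then show ?thesis using \<epsilon> by (intro mult_left_mono) auto
    qed
    also have "\<dots> = (1 + 1 / \<epsilon>) * K / \<kappa> * (x powr s * ln x powr \<delta>)"
      by (simp add: powr_s)
    finally show ?thesis .
  qed
  moreover have "(1 + 1 / \<epsilon>) * K / \<kappa> > 0"
    using \<epsilon> K \<kappa> by (intro divide_pos_pos mult_pos_pos add_pos_pos) auto
  ultimately show ?thesis using that by blast
qed

text \<open>
  Half of the power of \<open>n\<close> makes the separator weights decay geometrically down the recursion;
  the other half makes up for the logarithmic factor not being monotone when \<open>\<delta> < 0\<close>. At
  \<open>n \<le> 1\<close> the logarithmic factor is \<open>0\<close>.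
\<close>

lemma recursion_bound:
  fixes a c s \<delta> :: real
  assumes a: "0 < a" "a < 1" and s: "s > 0" and c: "c > 0"
  obtains h :: "nat \<Rightarrow> real" and K where "K > 0" "\<And>n. h n \<ge> 2"
    "\<And>m n. real m \<le> a * real n \<Longrightarrow> 2 * (c * real n powr s * ln (real n) powr \<delta>) + h m \<le> h n"
    "\<And>n. n \<ge> 2 \<Longrightarrow> h n \<le> 2 + K * (real n powr s * ln (real n) powr \<delta>)"
proof -
  define \<epsilon> where "\<epsilon> = s / 2"
  have \<epsilon>: "\<epsilon> > 0" using s by (simp add: \<epsilon>_def)
  have powr_s: "x powr s = x powr \<epsilon> * x powr \<epsilon>" for x :: real
    by (simp add: \<epsilon>_def powr_add[symmetric])
  obtain K where K: "K > 0"
    "\<And>x y. 2 \<le> x \<Longrightarrow> x \<le> y \<Longrightarrow> x powr \<epsilon> * ln x powr \<delta> \<le> K * (y powr \<epsilon> * ln y powr \<delta>)"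
    using powr_ln_powr_almost_mono[OF \<epsilon>] by metis
  define g where "g n = real n powr \<epsilon> * ln (real n) powr \<delta>" for n :: nat
  \<comment> \<open>A running maximum is monotone, so \<open>q n\<close> also serves for all smaller
    sizes; for \<open>n \<ge> 2\<close> it is at most \<open>K * g n\<close>.\<close>
  define q where "q n = Max (g ` {..n})" for n
  have g_le_q: "g m \<le> q n" if "m \<le> n" for m n
    unfolding q_def using that by (intro Max_ge) auto
  have q_mono: "q m \<le> q n" if "m \<le> n" for m n
    unfolding q_def using that by (intro Max_mono) auto
  have q_nonneg: "0 \<le> q n" for n
    using g_le_q[of 0 n] by (simp add: g_def)
  have a1: "a powr \<epsilon> < 1" using a \<epsilon> powr_less_mono2[of \<epsilon> a 1] by simp
  \<comment> \<open>The sum of the geometric series with ratio \<open>a powr \<epsilon>\<close>: as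
    the fixed point of \<open>M = 2 * c + M * a powr \<epsilon>\<close> it closes the
    recursion.\<close>
  define M where "M = 2 * c / (1 - a powr \<epsilon>)"
  have M: "M > 0" "2 * c + M * a powr \<epsilon> = M" using c a1 by (auto simp: M_def field_simps)
  define h where "h n = 2 + M * (real n powr \<epsilon> * q n)" for n
  show ?thesis
  proof (rule that[of "M * K" h])
    show "M * K > 0" using M K by simp
    show "h n \<ge> 2" for n using M q_nonneg by (simp add: h_def)
    show "2 * (c * real n powr s * ln (real n) powr \<delta>) + h m \<le> h n" if mn: "real m \<le> a * real n" for m n
    proof -
      have "a * real n \<le> 1 * real n" using a by (intro mult_right_mono) auto
      then have "m \<le> n" using mn by simp
      have "real m powr \<epsilon> * q m \<le> (a * real n) powr \<epsilon> * q n"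
        using mn \<epsilon> q_nonneg q_mono[OF \<open>m \<le> n\<close>] by (intro mult_mono powr_mono2) auto
      then have "M * (real m powr \<epsilon> * q m) \<le> M * a powr \<epsilon> * (real n powr \<epsilon> * q n)"
        using a M by (simp add: powr_mult mult.assoc)
      moreover have "2 * (c * real n powr s * ln (real n) powr \<delta>) = 2 * c * (real n powr \<epsilon> * g n)"
        by (simp add: g_def powr_s)
      moreover have "2 * c * (real n powr \<epsilon> * g n) \<le> 2 * c * (real n powr \<epsilon> * q n)"
        using c g_le_q by (intro mult_left_mono) auto
      ultimately have "2 * (c * real n powr s * ln (real n) powr \<delta>) + h m
          \<le> 2 + (2 * c + M * a powr \<epsilon>) * (real n powr \<epsilon> * q n)"
        unfolding h_def distrib_right by linarith
      then show ?thesis by (simp add: M h_def)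
    qed
    show "h n \<le> 2 + M * K * (real n powr s * ln (real n) powr \<delta>)" if n: "n \<ge> 2" for n
    proof -
      have "q n \<le> K * g n"
        unfolding q_def
      proof (rule Max.boundedI)
        fix y assume "y \<in> g ` {..n}"
        then obtain m where m: "m \<le> n" "y = g m" by auto
        show "y \<le> K * g n"
        proof (cases "m \<ge> 2")
          case True
          then show ?thesis using m K(2)[of "real m" "real n"] by (simp add: g_def)
        next
          case False
          then have "m = 0 \<or> m = 1" by auto
          then have "y = 0" using m by (auto simp: g_def)
          then show ?thesis using K by (simp add: g_def)
        qed
      qed auto
      then have "M * (real n powr \<epsilon> * q n) \<le> M * (real n powr \<epsilon> * (K * g n))"
        using M by (intro mult_left_mono) auto
      then show ?thesis by (simp add: h_def g_def powr_s mult_ac)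
    qed
  qed
qed

theorem theorem7:
  fixes \<C> :: "'a pair_pre_digraph set" and a b c \<delta> :: real
  assumes "graph_class \<C>" and "hereditary \<C>"
    and "0 < a" and "a < 1" and "b < 1" and "0 < c"
    and "\<forall>G\<in>\<C>. num_verts G \<ge> 2 \<longrightarrow>
      (\<exists>S. clique_based_separator a
        (c * real (num_verts G) powr (1 - b) * ln (real (num_verts G)) powr \<delta>) G S)"
  shows "\<exists>M>0. \<forall>G\<in>\<C>. num_verts G \<ge> 1 \<longrightarrow> (\<forall>lam>0.
    real (mixing_time G lam) \<le>
      (2 * exp \<bar>ln lam\<bar>) powr
        (M * (real (num_verts G) powr (1 - b) * ln (real (num_verts G)) powr \<delta>)))"
proof -
  let ?f = "\<lambda>n::nat. real n powr (1 - b) * ln (real n) powr \<delta>"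
  have s: "1 - b > 0" using assms(5) by simp
  obtain h :: "nat \<Rightarrow> real" and K where h: "K > 0" "\<And>n. h n \<ge> 2"
    "\<And>m n. real m \<le> a * real n \<Longrightarrow>
      2 * (c * real n powr (1 - b) * ln (real n) powr \<delta>) + h m \<le> h n"
    "\<And>n. n \<ge> 2 \<Longrightarrow> h n \<le> 2 + K * ?f n"
    using recursion_bound[OF assms(3,4) s assms(6), of \<delta>] by metis
  obtain K' where K': "K' > 0" "\<And>x. 2 \<le> x \<Longrightarrow> 1 + ln x \<le> K' * (x powr (1 - b) * ln x powr \<delta>)"
    using powr_ln_powr_lower_bound[OF s, of \<delta>] by metis
  \<comment> \<open>The final exponent is \<open>5 + 2 * log 2 n + h n\<close>. The \<open>5\<close>
    and the \<open>2\<close> in the bound for \<open>h n\<close> make up the \<open>7\<close>,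
    \<open>2 / ln 2\<close> converts \<open>2 * log 2 n\<close> to the natural logarithm, and
    \<open>K\<close> is the recursion itself.\<close>
  define M where "M = 7 * K' + 2 / ln 2 * K' + K"
  show ?thesis
  proof (intro exI[of _ M] conjI ballI impI allI)
    show "M > 0" using K' h by (simp add: M_def add_pos_pos)
    fix G :: "'a pair_pre_digraph" and lam :: real
    assume G: "G \<in> \<C>" and n1: "num_verts G \<ge> 1" and lam: "lam > 0"
    interpret pair_graph G using G assms(1) by (auto simp: graph_class_def)
    define n where "n = num_verts G"
    define L where "L = exp \<bar>ln lam\<bar>"
    note L = exp_abs_ln_bounds[OF lam, folded L_def]
    have "real (mixing_time G lam) \<le> (2 * L) powr (M * ?f n)"
    proof (cases "n = 1")
      case True
      then have "real (mixing_time G lam) \<le> 1"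
        using mixing_time_single_vertex[OF pair_graph_axioms _ lam] by (simp add: n_def)
      \<comment> \<open>Since \<open>ln 1 = 0\<close> and \<open>0 powr \<delta> = 0\<close> for
        every \<open>\<delta>\<close>, the right-hand side is exactly \<open>1\<close>.\<close>
      then show ?thesis using True L by simp
    next
      case False
      then have n: "n \<ge> 2" using n1 by (simp add: n_def)
      have "1 \<le> (2 * L) powr h n"
        using L h(2)[of n] by (intro ge_one_powr_ge_zero) auto
      moreover have "poincare (parcs G) lam (pverts G) ((2 * L) powr h n)"
        unfolding L_def n_def using assms(7) h(2,3)
        by (intro poincare_hereditary[OF assms(1,2,4) lam,
              of "\<lambda>n. c * real n powr (1 - b) * ln (real n) powr \<delta>"] G) auto
      ultimately have "real (mixing_time G lam) \<le> 8 * real n ^ 2 * (2 * L)\<^sup>2 * (2 * L) powr h n"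
        unfolding L_def n_def using n1 lam by (intro mixing_time_le_poincare[OF pair_graph_axioms]) auto
      \<comment> \<open>Written as a power of \<open>2\<close>, the polynomial factor can be raised
        to the base \<open>2 * L \<ge> 2\<close>, after which all factors merge into one
        power.\<close>
      also have "8 * real n ^ 2 = 2 powr 3 * 2 powr (2 * log 2 n)"
      proof -
        have "2 powr (2 * log 2 n) = (2 powr log 2 n) powr 2" by (simp add: powr_powr mult.commute)
        then show ?thesis using n by simp
      qed
      also have "2 powr 3 * 2 powr (2 * log 2 n) = 2 powr (3 + 2 * log 2 n)"
        by (simp add: powr_add)
      also have "\<dots> * (2 * L)\<^sup>2 * (2 * L) powr h n
          \<le> (2 * L) powr (3 + 2 * log 2 n) * (2 * L)\<^sup>2 * (2 * L) powr h n"
        using L n by (intro mult_right_mono powr_mono2) auto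
      also have "(2 * L)\<^sup>2 = (2 * L) powr 2" using L by simp
      also have "(2 * L) powr (3 + 2 * log 2 n) * (2 * L) powr 2 * (2 * L) powr h n
          = (2 * L) powr (5 + 2 * log 2 n + h n)"
        by (simp add: powr_add[symmetric] add.commute add.left_commute)
      also have "\<dots> \<le> (2 * L) powr (M * ?f n)"
      proof (rule powr_mono)
        have "0 \<le> ln (real n)" "1 + ln (real n) \<le> K' * ?f n" using n K'(2)[of "real n"] by auto
        then have *: "1 \<le> K' * ?f n" "ln (real n) \<le> K' * ?f n" by linarith+
        have "2 / ln 2 * ln (real n) \<le> 2 / ln 2 * (K' * ?f n)"
          using *(2) by (intro mult_left_mono) auto
        then have "2 * log 2 n \<le> 2 / ln 2 * (K' * ?f n)"
          by (simp add: log_def)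
        then have "5 + 2 * log 2 n + h n \<le> 7 * (K' * ?f n) + 2 / ln 2 * (K' * ?f n) + K * ?f n"
          using h(4)[OF n] * by linarith
        also have "\<dots> = M * ?f n" unfolding M_def by (simp only: distrib_right mult.assoc)
        finally show "5 + 2 * log 2 n + h n \<le> M * ?f n" .
      qed (use L in simp)
      finally show ?thesis .
    qed
    then show "real (mixing_time G lam) \<le> (2 * exp \<bar>ln lam\<bar>) powr (M * ?f (num_verts G))"
      by (simp add: L_def n_def)
  qed
qed

end
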